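(* Let $A=A(\mathbf q,a_1,\dots,a_n)$ be a quantum complete intersection over a field $k$ (with $n\ge 2$ and all $a_i\ge 2$). The following are equivalent. (1) The algebra $A$ admits a Hopf algebra structure. (2) The algebra $A$ admits a bialgebra structure. (3) $A$ is commutative, $p=\mathrm{char}\,k$ is a prime, and each $a_i$ is a positive power of $p$.
   Context: Let $k$ be a field, $n\ge 2$, $a_1,\dots,a_n\ge 2$ integers, and $\mathbf q=(q_{ij})$ an $n\times n$ matrix over $k$ with $q_{ii}=-1$ and $q_{ij}q_{ji}=1$ for all $i,j$. The quantum complete intersection is the $k$-algebra $A(\mathbf q,a_1,\dots,a_n)=k\langle x_1,\dots,x_n\rangle/\langle x_i^{a_i},\ x_ix_j+q_{ij}x_jx_i,\ 1\le i,j\le n\rangle$. "Admits a bialgebra (Hopf algebra) structure" means that there exist a comultiplication and a counit (and an antipode) making the given algebra a bialgebra (Hopf algebra). *)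

theory Defs
  imports "HOL-Computational_Algebra.Primes" "HOL-Library.Poly_Mapping"
    "HOL-Algebra.QuotRing" "HOL-Algebra.Module"
begin

text \<open>
  The ground field is a type of class \<open>field\<close>. Algebras over it are records of type
  \<open>('k, 'a) module\<close> with explicit carriers, because a quotient by an ideal depending on parameters
  is not a type. The locale \<open>algebra\<close> of HOL-Algebra is not used since it includes commutativity.
\<close>

definition ground_alg :: "('k::field, 'k) module" where
  "ground_alg = \<lparr>carrier = UNIV, mult = (*), one = 1, zero = 0, add = (+), smult = (*)\<rparr>"

definition alg_hom :: "('k::field, 'a) module \<Rightarrow> ('k, 'b) module \<Rightarrow> ('a \<Rightarrow> 'b) set" where
  "alg_hom A B = {f \<in> ring_hom A B. \<forall>c. \<forall>x\<in>carrier A. f (c \<odot>\<^bsub>A\<^esub> x) = c \<odot>\<^bsub>B\<^esub> f x}"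

definition lin_map :: "('k::field, 'a) module \<Rightarrow> ('k, 'b) module \<Rightarrow> ('a \<Rightarrow> 'b) set" where
  "lin_map A B = {f \<in> carrier A \<rightarrow> carrier B.
     (\<forall>x\<in>carrier A. \<forall>y\<in>carrier A. f (x \<oplus>\<^bsub>A\<^esub> y) = f x \<oplus>\<^bsub>B\<^esub> f y) \<and>
     (\<forall>c. \<forall>x\<in>carrier A. f (c \<odot>\<^bsub>A\<^esub> x) = c \<odot>\<^bsub>B\<^esub> f x)}"

text \<open>The quotient ring \<open>R Quot I\<close> of HOL-Algebra together with the induced scalar multiplication
  \<open>c \<odot> (I + x) = I + c \<odot> x\<close>; the union makes this independent of the representative, in the
  same way as \<open>rcoset_mult\<close>.\<close>

definition quot_alg :: "('k::field, 'a) module \<Rightarrow> 'a set \<Rightarrow> ('k, 'a set) module" where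
  "quot_alg R I = ring.extend (R Quot I)
     (module.fields (\<lambda>c X. \<Union>x\<in>X. I +>\<^bsub>R\<^esub> (c \<odot>\<^bsub>R\<^esub> x)))"

text \<open>The monoid algebra \<open>k[G]\<close>: finitely supported functions on \<open>carrier G\<close> with convolution.\<close>

definition monoid_alg :: "('g, 'm) monoid_scheme \<Rightarrow> ('k::field, 'g \<Rightarrow>\<^sub>0 'k) module" where
  "monoid_alg G =
     \<lparr>carrier = {p. Poly_Mapping.keys p \<subseteq> carrier G},
      mult = (\<lambda>p r. \<Sum>x\<in>Poly_Mapping.keys p. \<Sum>y\<in>Poly_Mapping.keys r.
        Poly_Mapping.single (x \<otimes>\<^bsub>G\<^esub> y) (Poly_Mapping.lookup p x * Poly_Mapping.lookup r y)),
      one = Poly_Mapping.single \<one>\<^bsub>G\<^esub> 1,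
      zero = 0,
      add = (+),
      smult = (\<lambda>c. Poly_Mapping.map ((*) c))\<rparr>"


section \<open>Tensor products\<close>

text \<open>The subspace of the free vector space on \<open>carrier A \<times> carrier B\<close> spanned by the bilinearity
  relations.\<close>

inductive_set tensor_null ::
  "('k::field, 'a) module \<Rightarrow> ('k, 'b) module \<Rightarrow> ('a \<times> 'b \<Rightarrow>\<^sub>0 'k) set"
  for A :: "('k, 'a) module" and B :: "('k, 'b) module"
where
  add_left: "\<lbrakk>x \<in> carrier A; y \<in> carrier A; z \<in> carrier B\<rbrakk> \<Longrightarrow>
    Poly_Mapping.single (x \<oplus>\<^bsub>A\<^esub> y, z) 1 - Poly_Mapping.single (x, z) 1
      - Poly_Mapping.single (y, z) 1 \<in> tensor_null A B"
| add_right: "\<lbrakk>x \<in> carrier A; y \<in> carrier B; z \<in> carrier B\<rbrakk> \<Longrightarrow>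
    Poly_Mapping.single (x, y \<oplus>\<^bsub>B\<^esub> z) 1 - Poly_Mapping.single (x, y) 1
      - Poly_Mapping.single (x, z) 1 \<in> tensor_null A B"
| smult_left: "\<lbrakk>x \<in> carrier A; z \<in> carrier B\<rbrakk> \<Longrightarrow>
    Poly_Mapping.single (c \<odot>\<^bsub>A\<^esub> x, z) 1 - Poly_Mapping.single (x, z) c \<in> tensor_null A B"
| smult_right: "\<lbrakk>x \<in> carrier A; z \<in> carrier B\<rbrakk> \<Longrightarrow>
    Poly_Mapping.single (x, c \<odot>\<^bsub>B\<^esub> z) 1 - Poly_Mapping.single (x, z) c \<in> tensor_null A B"
| span_zero: "0 \<in> tensor_null A B"
| span_add: "\<lbrakk>p \<in> tensor_null A B; r \<in> tensor_null A B\<rbrakk> \<Longrightarrow> p + r \<in> tensor_null A B"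
| span_smult: "p \<in> tensor_null A B \<Longrightarrow> Poly_Mapping.map ((*) c) p \<in> tensor_null A B"

text \<open>The free vector space on \<open>carrier A \<times> carrier B\<close> is the monoid algebra of the product of the
  multiplicative monoids of \<open>A\<close> and \<open>B\<close>, and \<open>tensor_null A B\<close> is an ideal of it. The quotient is
  therefore the usual tensor product, with \<open>(x \<otimes> y) (x' \<otimes> y') = x x' \<otimes> y y'\<close>.\<close>

definition tensor_alg ::
  "('k::field, 'a) module \<Rightarrow> ('k, 'b) module \<Rightarrow> ('k, ('a \<times> 'b \<Rightarrow>\<^sub>0 'k) set) module" where
  "tensor_alg A B = quot_alg (monoid_alg (A \<times>\<times> B)) (tensor_null A B)"

definition pure_tensor ::
  "('k::field, 'a) module \<Rightarrow> ('k, 'b) module \<Rightarrow> 'a \<Rightarrow> 'b \<Rightarrow> ('a \<times> 'b \<Rightarrow>\<^sub>0 'k) set" where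
  "pure_tensor A B x y =
     tensor_null A B +>\<^bsub>(monoid_alg (A \<times>\<times> B) :: ('k, _) module)\<^esub> Poly_Mapping.single (x, y) 1"

text \<open>For bilinear \<open>\<beta>\<close> into \<open>C\<close>, the linear map with \<open>x \<otimes> y \<mapsto> \<beta> x y\<close>. Its value on a coset \<open>X\<close> is
  the common value of \<open>\<Sum>c \<odot> \<beta> x y\<close> over all representatives \<open>\<Sum>c (x, y)\<close> of \<open>X\<close>; no meaning is
  attached to it when \<open>\<beta>\<close> is not bilinear.\<close>

definition tensor_lift ::
  "('k::field, 'c) module \<Rightarrow> ('a \<Rightarrow> 'b \<Rightarrow> 'c) \<Rightarrow> ('a \<times> 'b \<Rightarrow>\<^sub>0 'k) set \<Rightarrow> 'c" where
  "tensor_lift C \<beta> X = the_elem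
     ((\<lambda>p. \<Oplus>\<^bsub>C\<^esub>u\<in>Poly_Mapping.keys p. Poly_Mapping.lookup p u \<odot>\<^bsub>C\<^esub> \<beta> (fst u) (snd u)) ` X)"

text \<open>\<open>tensor_map C D f g\<close> is \<open>f \<otimes> g\<close>, where \<open>C\<close> and \<open>D\<close> are the codomains of \<open>f\<close> and \<open>g\<close>.\<close>

definition tensor_map :: "('k::field, 'c) module \<Rightarrow> ('k, 'd) module \<Rightarrow> ('a \<Rightarrow> 'c) \<Rightarrow> ('b \<Rightarrow> 'd) \<Rightarrow>
    ('a \<times> 'b \<Rightarrow>\<^sub>0 'k) set \<Rightarrow> ('c \<times> 'd \<Rightarrow>\<^sub>0 'k) set" where
  "tensor_map C D f g = tensor_lift (tensor_alg C D) (\<lambda>x y. pure_tensor C D (f x) (g y))"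

text \<open>The canonical isomorphism \<open>(A \<otimes> B) \<otimes> C \<rightarrow> A \<otimes> (B \<otimes> C)\<close>.\<close>

definition tensor_assoc :: "('k::field, 'a) module \<Rightarrow> ('k, 'b) module \<Rightarrow> ('k, 'c) module \<Rightarrow>
    (('a \<times> 'b \<Rightarrow>\<^sub>0 'k) set \<times> 'c \<Rightarrow>\<^sub>0 'k) set \<Rightarrow> ('a \<times> ('b \<times> 'c \<Rightarrow>\<^sub>0 'k) set \<Rightarrow>\<^sub>0 'k) set" where
  "tensor_assoc A B C =
     (let T = tensor_alg A (tensor_alg B C) in
      tensor_lift T (\<lambda>X z. tensor_lift T
        (\<lambda>x y. pure_tensor A (tensor_alg B C) x (pure_tensor B C y z)) X))"


section \<open>Bialgebras and Hopf algebras\<close>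

text \<open>Here \<open>A\<close> is understood to be a unital associative algebra. The counit axioms are stated after
  the identifications of \<open>k \<otimes> A\<close> and \<open>A \<otimes> k\<close> with \<open>A\<close>.\<close>

definition is_bialgebra ::
  "('k::field, 'a) module \<Rightarrow> ('a \<Rightarrow> ('a \<times> 'a \<Rightarrow>\<^sub>0 'k) set) \<Rightarrow> ('a \<Rightarrow> 'k) \<Rightarrow> bool" where
  "is_bialgebra A \<Delta> \<epsilon> \<longleftrightarrow>
     \<Delta> \<in> alg_hom A (tensor_alg A A) \<and> \<epsilon> \<in> alg_hom A ground_alg \<and>
     (\<forall>x\<in>carrier A.
        tensor_assoc A A A (tensor_map (tensor_alg A A) A \<Delta> (\<lambda>y. y) (\<Delta> x))
          = tensor_map A (tensor_alg A A) (\<lambda>y. y) \<Delta> (\<Delta> x) \<and>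
        tensor_lift A (\<lambda>y z. \<epsilon> y \<odot>\<^bsub>A\<^esub> z) (\<Delta> x) = x \<and>
        tensor_lift A (\<lambda>y z. \<epsilon> z \<odot>\<^bsub>A\<^esub> y) (\<Delta> x) = x)"

definition is_antipode ::
  "('k::field, 'a) module \<Rightarrow> ('a \<Rightarrow> ('a \<times> 'a \<Rightarrow>\<^sub>0 'k) set) \<Rightarrow> ('a \<Rightarrow> 'k) \<Rightarrow> ('a \<Rightarrow> 'a) \<Rightarrow> bool" where
  "is_antipode A \<Delta> \<epsilon> S \<longleftrightarrow>
     S \<in> lin_map A A \<and>
     (\<forall>x\<in>carrier A.
        tensor_lift A (\<lambda>y z. S y \<otimes>\<^bsub>A\<^esub> z) (\<Delta> x) = \<epsilon> x \<odot>\<^bsub>A\<^esub> \<one>\<^bsub>A\<^esub> \<and>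
        tensor_lift A (\<lambda>y z. y \<otimes>\<^bsub>A\<^esub> S z) (\<Delta> x) = \<epsilon> x \<odot>\<^bsub>A\<^esub> \<one>\<^bsub>A\<^esub>)"

definition admits_bialgebra :: "('k::field, 'a) module \<Rightarrow> bool" where
  "admits_bialgebra A \<longleftrightarrow> (\<exists>\<Delta> \<epsilon>. is_bialgebra A \<Delta> \<epsilon>)"

definition admits_hopf_algebra :: "('k::field, 'a) module \<Rightarrow> bool" where
  "admits_hopf_algebra A \<longleftrightarrow> (\<exists>\<Delta> \<epsilon> S. is_bialgebra A \<Delta> \<epsilon> \<and> is_antipode A \<Delta> \<epsilon> S)"


section \<open>Quantum complete intersections\<close>

definition free_alg :: "nat \<Rightarrow> ('k::field, nat list \<Rightarrow>\<^sub>0 'k) module" where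
  "free_alg n = monoid_alg \<lparr>carrier = lists {1..n}, mult = (@), one = []\<rparr>"

definition free_gen :: "nat \<Rightarrow> nat list \<Rightarrow>\<^sub>0 'k::field" where
  "free_gen i = Poly_Mapping.single [i] 1"

definition qci_rels ::
  "nat \<Rightarrow> (nat \<Rightarrow> nat \<Rightarrow> 'k::field) \<Rightarrow> (nat \<Rightarrow> nat) \<Rightarrow> (nat list \<Rightarrow>\<^sub>0 'k) set" where
  "qci_rels n q a =
     {free_gen i [^]\<^bsub>(free_alg n :: ('k, _) module)\<^esub> a i | i. i \<in> {1..n}} \<union>
     {free_gen i \<otimes>\<^bsub>free_alg n\<^esub> free_gen j
        \<oplus>\<^bsub>free_alg n\<^esub> q i j \<odot>\<^bsub>free_alg n\<^esub> (free_gen j \<otimes>\<^bsub>free_alg n\<^esub> free_gen i)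
      | i j. i \<in> {1..n} \<and> j \<in> {1..n}}"

definition qci ::
  "nat \<Rightarrow> (nat \<Rightarrow> nat \<Rightarrow> 'k::field) \<Rightarrow> (nat \<Rightarrow> nat) \<Rightarrow> ('k, (nat list \<Rightarrow>\<^sub>0 'k) set) module" where
  "qci n q a = quot_alg (free_alg n) (Idl\<^bsub>(free_alg n :: ('k, _) module)\<^esub> (qci_rels n q a))"

end

theory Submission
  imports Defs "HOL-Algebra.Exponent" "HOL-Computational_Algebra.Formal_Power_Series"
begin

text \<open>
  Let \<open>\<Delta>\<close>, \<open>\<epsilon>\<close> be a bialgebra structure. The counit kills the nilpotent generators, so it is the
  constant coefficient, and the counit axioms say that \<open>\<Delta> x\<^sub>i\<close> is
  \<open>x\<^sub>i \<otimes> 1 + 1 \<otimes> x\<^sub>i\<close> up to terms of positive degree in both factors. Comparing coefficients of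
  \<open>x\<^sub>i \<otimes> x\<^sub>j\<close> in \<open>\<Delta> x\<^sub>i \<Delta> x\<^sub>j + q\<^sub>i\<^sub>j \<Delta> x\<^sub>j \<Delta> x\<^sub>i = 0\<close> gives \<open>1 + q\<^sub>i\<^sub>j = 0\<close>, hence commutativity.
  Comparing coefficients of \<open>x\<^sub>i\<^sup>r \<otimes> x\<^sub>i\<^sup>s\<close> with \<open>r + s = a\<^sub>i\<close> in \<open>(\<Delta> x\<^sub>i)\<^sup>a\<^sup>i = 0\<close> gives
  \<open>a\<^sub>i choose r = 0\<close> in \<open>k\<close> for \<open>0 < r < a\<^sub>i\<close>, which forces \<open>a\<^sub>i\<close> to be a power of the
  characteristic. The coefficients are read off through the homomorphisms to \<open>k[X]/(X\<^sup>m)\<close> that keep a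
  single generator, so no monomial basis of the algebra is needed.

  Conversely, the freshman's dream shows that \<open>x\<^sub>i \<mapsto> x\<^sub>i \<otimes> 1 + 1 \<otimes> x\<^sub>i\<close>, \<open>x\<^sub>i \<mapsto> 0\<close> and
  \<open>x\<^sub>i \<mapsto> - x\<^sub>i\<close> respect the relations; as \<open>A\<close> is commutative, both sides of every axiom are algebra
  homomorphisms, and they agree on the generators.
\<close>

section \<open>Algebras over a field\<close>

text \<open>Scalars range over a whole type, so only the vectors carry carrier conditions. The last
  two axioms make scalars central, while the algebra itself may be noncommutative.\<close>

locale k_algebra = ring A for A :: "('k::field, 'a) module" (structure) +
  assumes smult_closed [simp, intro]: "x \<in> carrier A \<Longrightarrow> c \<odot> x \<in> carrier A"
    and smult_l_distr: "x \<in> carrier A \<Longrightarrow> (c + d) \<odot> x = c \<odot> x \<oplus> d \<odot> x"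
    and smult_r_distr: "\<lbrakk>x \<in> carrier A; y \<in> carrier A\<rbrakk> \<Longrightarrow> c \<odot> (x \<oplus> y) = c \<odot> x \<oplus> c \<odot> y"
    and smult_smult: "x \<in> carrier A \<Longrightarrow> c \<odot> (d \<odot> x) = (c * d) \<odot> x"
    and smult_1 [simp]: "x \<in> carrier A \<Longrightarrow> 1 \<odot> x = x"
    and smult_mult_l: "\<lbrakk>x \<in> carrier A; y \<in> carrier A\<rbrakk> \<Longrightarrow> (c \<odot> x) \<otimes> y = c \<odot> (x \<otimes> y)"
    and smult_mult_r: "\<lbrakk>x \<in> carrier A; y \<in> carrier A\<rbrakk> \<Longrightarrow> x \<otimes> (c \<odot> y) = c \<odot> (x \<otimes> y)"
begin

lemma smult_0 [simp]: "x \<in> carrier A \<Longrightarrow> 0 \<odot> x = \<zero>"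
  using smult_l_distr[of x 0 0] by (metis add.l_cancel_one smult_closed add_0)

lemma smult_zero [simp]: "c \<odot> \<zero> = \<zero>"
  using smult_r_distr[of \<zero> \<zero> c] by (metis add.l_cancel_one smult_closed zero_closed l_zero)

lemma smult_minus_one: "x \<in> carrier A \<Longrightarrow> (-1) \<odot> x = \<ominus> x"
  using smult_l_distr[of x 1 "-1"] by (metis add.inv_equality smult_0 smult_1 smult_closed
      add.m_comm add.right_inverse)

lemma smult_finsum:
  "finite K \<Longrightarrow> (\<And>u. u \<in> K \<Longrightarrow> f u \<in> carrier A) \<Longrightarrow>
    c \<odot> (\<Oplus>u\<in>K. f u) = (\<Oplus>u\<in>K. c \<odot> f u)"
proof (induction K rule: finite_induct)
  case (insert u K)
  then have "f \<in> K \<rightarrow> carrier A" "(\<lambda>u. c \<odot> f u) \<in> K \<rightarrow> carrier A" by auto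
  with insert show ?case by (simp add: finsum_insert smult_r_distr)
qed simp

end

section \<open>Algebra homomorphisms and linear maps\<close>

lemma alg_homD:
  assumes "f \<in> alg_hom A B"
  shows "x \<in> carrier A \<Longrightarrow> f x \<in> carrier B"
    and "x \<in> carrier A \<Longrightarrow> y \<in> carrier A \<Longrightarrow> f (x \<otimes>\<^bsub>A\<^esub> y) = f x \<otimes>\<^bsub>B\<^esub> f y"
    and "x \<in> carrier A \<Longrightarrow> y \<in> carrier A \<Longrightarrow> f (x \<oplus>\<^bsub>A\<^esub> y) = f x \<oplus>\<^bsub>B\<^esub> f y"
    and "f \<one>\<^bsub>A\<^esub> = \<one>\<^bsub>B\<^esub>"
    and "x \<in> carrier A \<Longrightarrow> f (c \<odot>\<^bsub>A\<^esub> x) = c \<odot>\<^bsub>B\<^esub> f x"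
  using assms by (auto simp: alg_hom_def ring_hom_def)

lemma alg_homI:
  assumes "\<And>x. x \<in> carrier A \<Longrightarrow> f x \<in> carrier B"
    and "\<And>x y. x \<in> carrier A \<Longrightarrow> y \<in> carrier A \<Longrightarrow> f (x \<otimes>\<^bsub>A\<^esub> y) = f x \<otimes>\<^bsub>B\<^esub> f y"
    and "\<And>x y. x \<in> carrier A \<Longrightarrow> y \<in> carrier A \<Longrightarrow> f (x \<oplus>\<^bsub>A\<^esub> y) = f x \<oplus>\<^bsub>B\<^esub> f y"
    and "f \<one>\<^bsub>A\<^esub> = \<one>\<^bsub>B\<^esub>"
    and "\<And>x c. x \<in> carrier A \<Longrightarrow> f (c \<odot>\<^bsub>A\<^esub> x) = c \<odot>\<^bsub>B\<^esub> f x"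
  shows "f \<in> alg_hom A B"
  using assms by (auto simp: alg_hom_def ring_hom_def)

lemma lin_mapD:
  assumes "f \<in> lin_map A B"
  shows "x \<in> carrier A \<Longrightarrow> f x \<in> carrier B"
    and "x \<in> carrier A \<Longrightarrow> y \<in> carrier A \<Longrightarrow> f (x \<oplus>\<^bsub>A\<^esub> y) = f x \<oplus>\<^bsub>B\<^esub> f y"
    and "x \<in> carrier A \<Longrightarrow> f (c \<odot>\<^bsub>A\<^esub> x) = c \<odot>\<^bsub>B\<^esub> f x"
  using assms by (auto simp: lin_map_def)

lemma lin_mapI:
  assumes "\<And>x. x \<in> carrier A \<Longrightarrow> f x \<in> carrier B"
    and "\<And>x y. x \<in> carrier A \<Longrightarrow> y \<in> carrier A \<Longrightarrow> f (x \<oplus>\<^bsub>A\<^esub> y) = f x \<oplus>\<^bsub>B\<^esub> f y"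
    and "\<And>x c. x \<in> carrier A \<Longrightarrow> f (c \<odot>\<^bsub>A\<^esub> x) = c \<odot>\<^bsub>B\<^esub> f x"
  shows "f \<in> lin_map A B"
  using assms by (auto simp: lin_map_def)

lemma alg_hom_lin_map: "f \<in> alg_hom A B \<Longrightarrow> f \<in> lin_map A B"
  by (auto simp: alg_hom_def lin_map_def ring_hom_def)

lemma alg_hom_comp: "f \<in> alg_hom A B \<Longrightarrow> g \<in> alg_hom B C \<Longrightarrow> (\<lambda>x. g (f x)) \<in> alg_hom A C"
  by (auto simp: alg_hom_def ring_hom_def Pi_def)

lemma lin_map_zero:
  assumes "k_algebra A" "k_algebra B" "f \<in> lin_map A B"
  shows "f \<zero>\<^bsub>A\<^esub> = \<zero>\<^bsub>B\<^esub>"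
proof -
  interpret A: k_algebra A by fact
  interpret B: k_algebra B by fact
  show ?thesis
    using lin_mapD(3)[OF assms(3), of "\<zero>\<^bsub>A\<^esub>" 0] lin_mapD(1)[OF assms(3), of "\<zero>\<^bsub>A\<^esub>"] by simp
qed

text \<open>Gives access to the facts on powers and kernels proved for
  \<open>ring_hom_ring\<close>.\<close>

lemma alg_hom_ring_hom_ring:
  assumes "k_algebra A" "k_algebra B" "f \<in> alg_hom A B"
  shows "ring_hom_ring A B f"
  using assms by (auto intro!: ring_hom_ringI2 simp: alg_hom_def k_algebra_def)

lemma k_algebra_ground_alg: "k_algebra (ground_alg :: ('k::field, 'k) module)"
proof -
  have "ring (ground_alg :: ('k::field, 'k) module)"
    by (intro ringI abelian_groupI monoidI)
      (auto simp: ground_alg_def algebra_simps intro: exI[of _ "- _"])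
  then show ?thesis
    by (intro k_algebra.intro k_algebra_axioms.intro)
      (auto simp: ground_alg_def algebra_simps)
qed

lemma ground_alg_simps [simp]:
  "carrier ground_alg = UNIV" "x \<otimes>\<^bsub>ground_alg\<^esub> y = x * y" "\<one>\<^bsub>ground_alg\<^esub> = 1"
  "\<zero>\<^bsub>ground_alg\<^esub> = 0" "x \<oplus>\<^bsub>ground_alg\<^esub> y = x + y" "c \<odot>\<^bsub>ground_alg\<^esub> x = c * x"
  by (simp_all add: ground_alg_def)

lemma ground_alg_pow: "x [^]\<^bsub>(ground_alg :: ('k::field, 'k) module)\<^esub> (m::nat) = x ^ m"
  by (induction m) (simp_all add: nat_pow_def)


section \<open>Finitely supported functions\<close>

lemma lookup_scale [simp]:
  "Poly_Mapping.lookup (Poly_Mapping.map ((*) (c::'k::field)) p) u = c * Poly_Mapping.lookup p u"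
  by transfer (auto simp: when_def)

lemma scale_add: "Poly_Mapping.map ((*) (c::'k::field)) (p + r) =
    Poly_Mapping.map ((*) c) p + Poly_Mapping.map ((*) c) r"
  by (rule poly_mapping_eqI) (simp add: lookup_add algebra_simps)

lemma scale_single [simp]: "Poly_Mapping.map ((*) (c::'k::field)) (Poly_Mapping.single u d) =
    Poly_Mapping.single u (c * d)"
  by (rule poly_mapping_eqI) (simp add: lookup_single when_def)

lemma scale_zero [simp]: "Poly_Mapping.map ((*) (c::'k::field)) 0 = 0"
  by (rule poly_mapping_eqI) simp

lemma scale_add_left: "Poly_Mapping.map ((*) (c + d::'k::field)) p =
    Poly_Mapping.map ((*) c) p + Poly_Mapping.map ((*) d) p"
  by (rule poly_mapping_eqI) (simp add: lookup_add algebra_simps)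

lemma scale_scale: "Poly_Mapping.map ((*) (c::'k::field)) (Poly_Mapping.map ((*) d) p) =
    Poly_Mapping.map ((*) (c * d)) p"
  by (rule poly_mapping_eqI) (simp add: mult.assoc)

lemma scale_one: "Poly_Mapping.map ((*) (1::'k::field)) p = p"
  by (rule poly_mapping_eqI) simp

lemma keys_scale_subset:
  "Poly_Mapping.keys p \<subseteq> S \<Longrightarrow> Poly_Mapping.keys (Poly_Mapping.map ((*) (c::'k::field)) p) \<subseteq> S"
  by (auto simp: in_keys_iff)

lemma keys_add_subset:
  "Poly_Mapping.keys p \<subseteq> S \<Longrightarrow> Poly_Mapping.keys r \<subseteq> S \<Longrightarrow> Poly_Mapping.keys (p + r) \<subseteq> S"
  using keys_add[of p r] by blast

lemma keys_diff_subset: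
  fixes p r :: "'u \<Rightarrow>\<^sub>0 'k::field"
  assumes "Poly_Mapping.keys p \<subseteq> S" "Poly_Mapping.keys r \<subseteq> S"
  shows "Poly_Mapping.keys (p - r) \<subseteq> S"
proof
  fix x assume "x \<in> Poly_Mapping.keys (p - r)"
  then have "x \<in> Poly_Mapping.keys p \<or> x \<in> Poly_Mapping.keys r"
    by (auto simp: in_keys_iff lookup_minus)
  then show "x \<in> S" using assms by blast
qed

lemma keys_single_subset: "u \<in> S \<Longrightarrow> Poly_Mapping.keys (Poly_Mapping.single u c) \<subseteq> S"
  by auto

text \<open>Peeling off one key at a time builds \<open>p\<close> from \<open>single\<close> terms.
  The bound \<open>S\<close> on the support keeps carrier membership available in the induction
  step, so that linear identities over a carrier reduce to basis elements.\<close>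

lemma pm_induct [consumes 1, case_names zero add]:
  fixes p :: "'u \<Rightarrow>\<^sub>0 'k::field"
  assumes "Poly_Mapping.keys p \<subseteq> S"
    and "P 0"
    and "\<And>u c p :: 'u \<Rightarrow>\<^sub>0 'k. \<lbrakk>u \<in> S; Poly_Mapping.keys p \<subseteq> S; P p\<rbrakk> \<Longrightarrow> P (Poly_Mapping.single u c + p)"
  shows "P p"
proof -
  have "P p" if "Poly_Mapping.keys p = K" "finite K" "K \<subseteq> S" for K and p :: "'u \<Rightarrow>\<^sub>0 'k"
    using that(2,1,3)
  proof (induction K arbitrary: p rule: finite_induct)
    case empty
    then show ?case using assms(2) by simp
  next
    case (insert u K)
    define r where "r = p - Poly_Mapping.single u (Poly_Mapping.lookup p u)"
    have r: "Poly_Mapping.lookup r v = (if v = u then 0 else Poly_Mapping.lookup p v)" for v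
      by (simp add: r_def lookup_minus lookup_single when_def)
    have "Poly_Mapping.keys r = K"
      using insert by (auto simp: in_keys_iff[symmetric] r in_keys_iff[of _ r] split: if_splits)
    then have "P r" using insert by auto
    moreover have "p = Poly_Mapping.single u (Poly_Mapping.lookup p u) + r"
      by (simp add: r_def)
    ultimately show ?case using assms(3)[of u r] insert \<open>Poly_Mapping.keys r = K\<close> by (metis insert_subset)
  qed
  then show ?thesis using assms(1) by auto
qed

section \<open>Linear extension from a free vector space\<close>

definition lin_ext :: "('k::field, 'c) module \<Rightarrow> ('u \<Rightarrow> 'c) \<Rightarrow> ('u \<Rightarrow>\<^sub>0 'k) \<Rightarrow> 'c" where
  "lin_ext C f p = (\<Oplus>\<^bsub>C\<^esub>u\<in>Poly_Mapping.keys p. Poly_Mapping.lookup p u \<odot>\<^bsub>C\<^esub> f u)"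

context k_algebra
begin

text \<open>Indices outside the support contribute zero. Hence functions with different supports can
  be summed over one common finite set, which is what additivity requires.\<close>

lemma lin_ext_superset:
  assumes "f \<in> S \<rightarrow> carrier A" "finite S" "Poly_Mapping.keys p \<subseteq> S"
  shows "lin_ext A f p = (\<Oplus>u\<in>S. Poly_Mapping.lookup p u \<odot> f u)"
  unfolding lin_ext_def
  by (rule add.finprod_mono_neutral_cong_left)
    (use assms in \<open>auto simp: in_keys_iff Pi_iff\<close>)

lemma lin_ext_closed:
  assumes "f \<in> S \<rightarrow> carrier A" "Poly_Mapping.keys p \<subseteq> S"
  shows "lin_ext A f p \<in> carrier A"
  unfolding lin_ext_def using assms by (intro finsum_closed) auto

lemma lin_ext_add:
  assumes f: "f \<in> S \<rightarrow> carrier A" and p: "Poly_Mapping.keys p \<subseteq> S" and r: "Poly_Mapping.keys r \<subseteq> S"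
  shows "lin_ext A f (p + r) = lin_ext A f p \<oplus> lin_ext A f r"
proof -
  define K where "K = Poly_Mapping.keys p \<union> Poly_Mapping.keys r"
  have K: "f \<in> K \<rightarrow> carrier A" "finite K" "Poly_Mapping.keys p \<subseteq> K" "Poly_Mapping.keys r \<subseteq> K"
    "Poly_Mapping.keys (p + r) \<subseteq> K"
    using assms keys_add[of p r] by (auto simp: K_def)
  have "lin_ext A f (p + r) = (\<Oplus>u\<in>K. Poly_Mapping.lookup p u \<odot> f u \<oplus> Poly_Mapping.lookup r u \<odot> f u)"
    unfolding lin_ext_superset[OF K(1,2,5)] using K(1)
    by (intro finsum_cong') (auto simp: lookup_add smult_l_distr Pi_iff)
  then show ?thesis
    using K by (subst (asm) finsum_addf) (auto simp: lin_ext_superset[OF K(1,2)] Pi_iff K)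
qed

lemma lin_ext_scale:
  assumes f: "f \<in> S \<rightarrow> carrier A" and p: "Poly_Mapping.keys p \<subseteq> S"
  shows "lin_ext A f (Poly_Mapping.map ((*) c) p) = c \<odot> lin_ext A f p"
proof -
  define K where "K = Poly_Mapping.keys p"
  have K: "f \<in> K \<rightarrow> carrier A" "finite K" "Poly_Mapping.keys p \<subseteq> K"
    "Poly_Mapping.keys (Poly_Mapping.map ((*) c) p) \<subseteq> K"
    using assms keys_scale_subset[of p _ c] by (auto simp: K_def)
  show ?thesis
    unfolding lin_ext_superset[OF K(1,2,3)] lin_ext_superset[OF K(1,2,4)] using K(1,2)
    by (subst smult_finsum) (auto simp: smult_smult Pi_iff intro!: finsum_cong')
qed

lemma lin_ext_single:
  assumes "f u \<in> carrier A"
  shows "lin_ext A f (Poly_Mapping.single u c) = c \<odot> f u"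
proof -
  have "lin_ext A f (Poly_Mapping.single u c) = (\<Oplus>v\<in>{u}. Poly_Mapping.lookup (Poly_Mapping.single u c) v \<odot> f v)"
    by (rule lin_ext_superset) (use assms in auto)
  then show ?thesis using assms by simp
qed

lemma lin_ext_zero [simp]: "lin_ext A f 0 = \<zero>"
  by (simp add: lin_ext_def)

lemma lin_ext_diff:
  assumes f: "f \<in> S \<rightarrow> carrier A" and p: "Poly_Mapping.keys p \<subseteq> S" and r: "Poly_Mapping.keys r \<subseteq> S"
  shows "lin_ext A f (p - r) = lin_ext A f p \<ominus> lin_ext A f r"
proof -
  have k: "Poly_Mapping.keys (p - r) \<subseteq> S"
    using keys_add[of p "-r"] p r by (auto simp: in_keys_iff lookup_minus)
  have "lin_ext A f p = lin_ext A f (p - r) \<oplus> lin_ext A f r"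
    using lin_ext_add[OF f k r] by simp
  then show ?thesis
    using lin_ext_closed[OF f k] lin_ext_closed[OF f r] by (simp add: minus_eq a_assoc r_neg)
qed

end


section \<open>Monoid algebras\<close>

lemma monoid_alg_simps [simp]:
  "carrier (monoid_alg G) = {p. Poly_Mapping.keys p \<subseteq> carrier G}"
  "\<one>\<^bsub>monoid_alg G\<^esub> = Poly_Mapping.single \<one>\<^bsub>G\<^esub> 1"
  "\<zero>\<^bsub>monoid_alg G\<^esub> = 0"
  "p \<oplus>\<^bsub>monoid_alg G\<^esub> r = p + r"
  "c \<odot>\<^bsub>monoid_alg G\<^esub> p = Poly_Mapping.map ((*) c) p"
  by (simp_all add: monoid_alg_def)

text \<open>The index sets can be enlarged because the extra terms have coefficient zero;
  distributivity then becomes a computation over common index sets.\<close>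

lemma monoid_alg_mult_superset:
  assumes "finite S" "Poly_Mapping.keys p \<subseteq> S" "finite T" "Poly_Mapping.keys r \<subseteq> T"
  shows "p \<otimes>\<^bsub>monoid_alg G\<^esub> r = (\<Sum>x\<in>S. \<Sum>y\<in>T.
    Poly_Mapping.single (x \<otimes>\<^bsub>G\<^esub> y) (Poly_Mapping.lookup p x * Poly_Mapping.lookup r y))"
proof -
  have "p \<otimes>\<^bsub>monoid_alg G\<^esub> r = (\<Sum>x\<in>Poly_Mapping.keys p. \<Sum>y\<in>T.
    Poly_Mapping.single (x \<otimes>\<^bsub>G\<^esub> y) (Poly_Mapping.lookup p x * Poly_Mapping.lookup r y))"
    unfolding monoid_alg_def monoid.simps
    by (intro sum.cong refl sum.mono_neutral_left) (use assms in \<open>auto simp: in_keys_iff\<close>)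
  also have "\<dots> = (\<Sum>x\<in>S. \<Sum>y\<in>T.
    Poly_Mapping.single (x \<otimes>\<^bsub>G\<^esub> y) (Poly_Mapping.lookup p x * Poly_Mapping.lookup r y))"
    by (intro sum.mono_neutral_left) (use assms in \<open>auto simp: in_keys_iff\<close>)
  finally show ?thesis .
qed

lemma monoid_alg_mult_add_left:
  "(p + p') \<otimes>\<^bsub>monoid_alg G\<^esub> r = p \<otimes>\<^bsub>monoid_alg G\<^esub> r + p' \<otimes>\<^bsub>monoid_alg G\<^esub> r"
proof -
  let ?S = "Poly_Mapping.keys p \<union> Poly_Mapping.keys p'"
  note m = monoid_alg_mult_superset[of ?S _ "Poly_Mapping.keys r" r G]
  show ?thesis
    by (subst (1 2 3) m) (use keys_add[of p p'] in \<open>auto simp: lookup_add distrib_right single_add sum.distrib\<close>)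
qed

lemma monoid_alg_mult_add_right:
  "r \<otimes>\<^bsub>monoid_alg G\<^esub> (p + p') = r \<otimes>\<^bsub>monoid_alg G\<^esub> p + r \<otimes>\<^bsub>monoid_alg G\<^esub> p'"
proof -
  let ?S = "Poly_Mapping.keys p \<union> Poly_Mapping.keys p'"
  note m = monoid_alg_mult_superset[of "Poly_Mapping.keys r" r ?S _ G]
  show ?thesis
    by (subst (1 2 3) m) (use keys_add[of p p'] in \<open>auto simp: lookup_add distrib_left single_add sum.distrib\<close>)
qed

lemma monoid_alg_mult_single [simp]:
  "Poly_Mapping.single u c \<otimes>\<^bsub>monoid_alg G\<^esub> Poly_Mapping.single v d = Poly_Mapping.single (u \<otimes>\<^bsub>G\<^esub> v) (c * d)"
  by (subst monoid_alg_mult_superset[of "{u}" _ "{v}"]) auto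

lemma monoid_alg_mult_zero [simp]:
  "0 \<otimes>\<^bsub>monoid_alg G\<^esub> r = 0" "r \<otimes>\<^bsub>monoid_alg G\<^esub> 0 = 0"
  by (simp_all add: monoid_alg_def)

context
  fixes G :: "('g, 'm) monoid_scheme"
  assumes G: "monoid G"
begin

interpretation G: monoid G by fact

lemma monoid_alg_mult_closed:
  assumes p: "Poly_Mapping.keys p \<subseteq> carrier G" and r: "Poly_Mapping.keys r \<subseteq> carrier G"
  shows "Poly_Mapping.keys (p \<otimes>\<^bsub>monoid_alg G\<^esub> r :: 'g \<Rightarrow>\<^sub>0 'k::field) \<subseteq> carrier G"
  using p
proof (induction rule: pm_induct)
  case (add u c p)
  have "Poly_Mapping.keys (Poly_Mapping.single u c \<otimes>\<^bsub>monoid_alg G\<^esub> r) \<subseteq> carrier G"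
    using r
    by (induction rule: pm_induct)
      (simp_all add: monoid_alg_mult_add_right add(1) keys_add_subset keys_single_subset del: keys_single)
  then show ?case using add by (simp add: monoid_alg_mult_add_left keys_add_subset)
qed simp

text \<open>Both sides are additive in each of the three factors, so three nested inductions reduce
  the claim to basis elements, where it is associativity in \<open>G\<close>.\<close>

lemma monoid_alg_mult_assoc:
  fixes p r s :: "'g \<Rightarrow>\<^sub>0 'k::field"
  assumes p: "Poly_Mapping.keys p \<subseteq> carrier G" and r: "Poly_Mapping.keys r \<subseteq> carrier G"
    and s: "Poly_Mapping.keys s \<subseteq> carrier G"
  shows "(p \<otimes>\<^bsub>monoid_alg G\<^esub> r) \<otimes>\<^bsub>monoid_alg G\<^esub> s = p \<otimes>\<^bsub>monoid_alg G\<^esub> (r \<otimes>\<^bsub>monoid_alg G\<^esub> s)"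
  using p
proof (induction rule: pm_induct)
  case (add u c p)
  have "(Poly_Mapping.single u c \<otimes>\<^bsub>monoid_alg G\<^esub> r) \<otimes>\<^bsub>monoid_alg G\<^esub> s
      = Poly_Mapping.single u c \<otimes>\<^bsub>monoid_alg G\<^esub> (r \<otimes>\<^bsub>monoid_alg G\<^esub> s)"
    using r
  proof (induction rule: pm_induct)
    case (add v d r)
    have "(Poly_Mapping.single u c \<otimes>\<^bsub>monoid_alg G\<^esub> Poly_Mapping.single v d) \<otimes>\<^bsub>monoid_alg G\<^esub> s
      = Poly_Mapping.single u c \<otimes>\<^bsub>monoid_alg G\<^esub> (Poly_Mapping.single v d \<otimes>\<^bsub>monoid_alg G\<^esub> s)"
      using s
      by (induction rule: pm_induct)
        (simp_all add: monoid_alg_mult_add_right G.m_assoc \<open>u \<in> carrier G\<close> \<open>v \<in> carrier G\<close> mult.assoc)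
    \<comment> \<open>The product of two \<open>single\<close> terms must stay unevaluated here,
      since the equation just shown is stated for that product.\<close>
    then show ?case using add by (simp add: monoid_alg_mult_add_left monoid_alg_mult_add_right
          del: monoid_alg_mult_single)
  qed simp
  then show ?case using add by (simp add: monoid_alg_mult_add_left)
qed simp

lemma monoid_alg_mult_one:
  fixes p :: "'g \<Rightarrow>\<^sub>0 'k::field"
  assumes p: "Poly_Mapping.keys p \<subseteq> carrier G"
  shows "Poly_Mapping.single \<one>\<^bsub>G\<^esub> 1 \<otimes>\<^bsub>monoid_alg G\<^esub> p = p"
    and "p \<otimes>\<^bsub>monoid_alg G\<^esub> Poly_Mapping.single \<one>\<^bsub>G\<^esub> 1 = p"
  using p by (induction rule: pm_induct)
    (auto simp: monoid_alg_mult_add_left monoid_alg_mult_add_right)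

lemma monoid_alg_scale_mult:
  fixes p r :: "'g \<Rightarrow>\<^sub>0 'k::field"
  assumes p: "Poly_Mapping.keys p \<subseteq> carrier G" and r: "Poly_Mapping.keys r \<subseteq> carrier G"
  shows "Poly_Mapping.map ((*) c) p \<otimes>\<^bsub>monoid_alg G\<^esub> r = Poly_Mapping.map ((*) c) (p \<otimes>\<^bsub>monoid_alg G\<^esub> r)"
    and "p \<otimes>\<^bsub>monoid_alg G\<^esub> Poly_Mapping.map ((*) c) r = Poly_Mapping.map ((*) c) (p \<otimes>\<^bsub>monoid_alg G\<^esub> r)"
proof -
  have "Poly_Mapping.map ((*) c) p \<otimes>\<^bsub>monoid_alg G\<^esub> r = Poly_Mapping.map ((*) c) (p \<otimes>\<^bsub>monoid_alg G\<^esub> r) \<and>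
     p \<otimes>\<^bsub>monoid_alg G\<^esub> Poly_Mapping.map ((*) c) r = Poly_Mapping.map ((*) c) (p \<otimes>\<^bsub>monoid_alg G\<^esub> r)"
    using p
  proof (induction rule: pm_induct)
    case zero
    then show ?case by simp
  next
    case (add u d p)
    have "Poly_Mapping.single u (c * d) \<otimes>\<^bsub>monoid_alg G\<^esub> r
        = Poly_Mapping.map ((*) c) (Poly_Mapping.single u d \<otimes>\<^bsub>monoid_alg G\<^esub> r) \<and>
      Poly_Mapping.single u d \<otimes>\<^bsub>monoid_alg G\<^esub> Poly_Mapping.map ((*) c) r
        = Poly_Mapping.map ((*) c) (Poly_Mapping.single u d \<otimes>\<^bsub>monoid_alg G\<^esub> r)"
      using r
    proof (induction rule: pm_induct)
      case zero
      then show ?case by simp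
    qed (simp add: monoid_alg_mult_add_right scale_add mult.assoc mult.left_commute)
    then show ?case using add by (simp add: monoid_alg_mult_add_left scale_add)
  qed
  then show "Poly_Mapping.map ((*) c) p \<otimes>\<^bsub>monoid_alg G\<^esub> r = Poly_Mapping.map ((*) c) (p \<otimes>\<^bsub>monoid_alg G\<^esub> r)"
    and "p \<otimes>\<^bsub>monoid_alg G\<^esub> Poly_Mapping.map ((*) c) r = Poly_Mapping.map ((*) c) (p \<otimes>\<^bsub>monoid_alg G\<^esub> r)"
    by auto
qed

lemma k_algebra_monoid_alg: "k_algebra (monoid_alg G :: ('k::field, _) module)"
proof (intro k_algebra.intro k_algebra_axioms.intro ringI abelian_groupI monoidI)
  fix p :: "'g \<Rightarrow>\<^sub>0 'k" assume "p \<in> carrier (monoid_alg G)"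
  then show "\<exists>y\<in>carrier (monoid_alg G). y \<oplus>\<^bsub>monoid_alg G\<^esub> p = \<zero>\<^bsub>monoid_alg G\<^esub>"
    by (intro bexI[of _ "- p"]) (auto simp: in_keys_iff)
qed (simp_all add: monoid_alg_mult_assoc monoid_alg_mult_one monoid_alg_scale_mult monoid_alg_mult_add_left
    monoid_alg_mult_add_right scale_add scale_add_left scale_scale scale_one ac_simps
    keys_add_subset keys_single_subset keys_scale_subset monoid_alg_mult_closed del: keys_single)

text \<open>Universal property of the monoid algebra: by additivity in both factors,
  multiplicativity only has to be checked on basis elements. It is applied to words for the free
  algebra and to pairs for the tensor product.\<close>

lemma lin_ext_alg_hom:
  assumes C: "k_algebra C" and f: "f \<in> carrier G \<rightarrow> carrier C"
    and mult: "\<And>u v. u \<in> carrier G \<Longrightarrow> v \<in> carrier G \<Longrightarrow> f (u \<otimes>\<^bsub>G\<^esub> v) = f u \<otimes>\<^bsub>C\<^esub> f v"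
    and one: "f \<one>\<^bsub>G\<^esub> = \<one>\<^bsub>C\<^esub>"
  shows "lin_ext C f \<in> alg_hom (monoid_alg G :: ('k::field, _) module) C"
proof (rule alg_homI)
  interpret C: k_algebra C by fact
  interpret M: k_algebra "monoid_alg G :: ('k, _) module" by (rule k_algebra_monoid_alg)
  note closed = C.lin_ext_closed[OF f] and ext_add = C.lin_ext_add[OF f]
  note fc = funcset_mem[OF f]
  fix p r :: "'g \<Rightarrow>\<^sub>0 'k" assume "p \<in> carrier (monoid_alg G)" "r \<in> carrier (monoid_alg G)"
  then have p: "Poly_Mapping.keys p \<subseteq> carrier G" and r: "Poly_Mapping.keys r \<subseteq> carrier G" by auto
  show "lin_ext C f (p \<otimes>\<^bsub>monoid_alg G\<^esub> r) = lin_ext C f p \<otimes>\<^bsub>C\<^esub> lin_ext C f r"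
    using p
  proof (induction rule: pm_induct)
    case zero
    then show ?case using closed[OF r] by simp
  next
    case (add u c p)
    have s: "Poly_Mapping.keys (Poly_Mapping.single v d) \<subseteq> carrier G" if "v \<in> carrier G" for v and d :: 'k
      using that by auto
    have "lin_ext C f (Poly_Mapping.single u c \<otimes>\<^bsub>monoid_alg G\<^esub> r)
        = lin_ext C f (Poly_Mapping.single u c) \<otimes>\<^bsub>C\<^esub> lin_ext C f r"
      using r
    proof (induction rule: pm_induct)
      case zero
      then show ?case using closed[OF s[OF add(1)]] by simp
    next
      case (add v d r)
      have "lin_ext C f (Poly_Mapping.single u c \<otimes>\<^bsub>monoid_alg G\<^esub> Poly_Mapping.single v d)
         = lin_ext C f (Poly_Mapping.single u c) \<otimes>\<^bsub>C\<^esub> lin_ext C f (Poly_Mapping.single v d)"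
        using \<open>u \<in> carrier G\<close> \<open>v \<in> carrier G\<close> fc mult
        by (simp add: C.lin_ext_single C.smult_mult_l C.smult_mult_r C.smult_smult mult.commute)
      then show ?case
        using add s \<open>u \<in> carrier G\<close> closed
        by (simp add: monoid_alg_mult_add_right ext_add monoid_alg_mult_closed C.r_distr
            del: monoid_alg_mult_single)
    qed
    then show ?case
      using add s r closed by (simp add: monoid_alg_mult_add_left ext_add monoid_alg_mult_closed C.l_distr)
  qed
  show "lin_ext C f (p \<oplus>\<^bsub>monoid_alg G\<^esub> r) = lin_ext C f p \<oplus>\<^bsub>C\<^esub> lin_ext C f r"
    using p r by (simp add: ext_add)
next
  interpret C: k_algebra C by fact
  fix p :: "'g \<Rightarrow>\<^sub>0 'k" and c
  assume p: "p \<in> carrier (monoid_alg G)"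
  show "lin_ext C f p \<in> carrier C" using p f C.lin_ext_closed by auto
  show "lin_ext C f (c \<odot>\<^bsub>monoid_alg G\<^esub> p) = c \<odot>\<^bsub>C\<^esub> lin_ext C f p" using p C.lin_ext_scale[OF f] by auto
next
  interpret C: k_algebra C by fact
  show "lin_ext C f \<one>\<^bsub>monoid_alg G\<^esub> = \<one>\<^bsub>C\<^esub>" using one by (simp add: C.lin_ext_single)
qed

end

lemma lin_ext_lin_map:
  assumes "k_algebra C" and f: "f \<in> carrier G \<rightarrow> carrier C"
  shows "lin_ext C f \<in> lin_map (monoid_alg G) C"
proof -
  interpret C: k_algebra C by fact
  show ?thesis
    by (rule lin_mapI) (simp_all add: C.lin_ext_closed[OF f] C.lin_ext_add[OF f] C.lin_ext_scale[OF f])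
qed


section \<open>Quotient algebras\<close>

lemma quot_alg_simps:
  "carrier (quot_alg R I) = carrier (R Quot I)"
  "mult (quot_alg R I) = mult (R Quot I)"
  "one (quot_alg R I) = one (R Quot I)"
  "zero (quot_alg R I) = zero (R Quot I)"
  "add (quot_alg R I) = add (R Quot I)"
  "smult (quot_alg R I) c X = (\<Union>x\<in>X. I +>\<^bsub>R\<^esub> (c \<odot>\<^bsub>R\<^esub> x))"
  by (simp_all add: quot_alg_def ring.defs module.defs)

text \<open>The common value of \<open>h\<close> on the coset, the same device as in
  \<open>tensor_lift\<close>. It is meaningful only if \<open>h\<close> is constant on
  \<open>X\<close>.\<close>

definition quot_lift :: "('a \<Rightarrow> 'b) \<Rightarrow> 'a set \<Rightarrow> 'b" where
  "quot_lift h X = the_elem (h ` X)"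

context
  fixes R :: "('k::field, 'a) module" and I :: "'a set"
  assumes R: "k_algebra R" and I: "ideal I R"
begin

interpretation R: k_algebra R by (rule R)
interpretation I: ideal I R by (rule I)

lemma quot_coset_closed [simp]: "x \<in> carrier R \<Longrightarrow> I +>\<^bsub>R\<^esub> x \<in> carrier (quot_alg R I)"
  by (simp add: quot_alg_simps FactRing_def R.a_rcosetsI I.a_subset)

lemma quot_cosetE:
  assumes "X \<in> carrier (quot_alg R I)"
  obtains x where "x \<in> carrier R" "X = I +>\<^bsub>R\<^esub> x"
  using assms by (auto simp: quot_alg_simps FactRing_simps)

lemma quot_mult:
  "x \<in> carrier R \<Longrightarrow> y \<in> carrier R \<Longrightarrow>
    (I +>\<^bsub>R\<^esub> x) \<otimes>\<^bsub>quot_alg R I\<^esub> (I +>\<^bsub>R\<^esub> y) = I +>\<^bsub>R\<^esub> (x \<otimes>\<^bsub>R\<^esub> y)"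
  by (simp add: quot_alg_simps FactRing_def I.rcoset_mult_add)

lemma quot_add:
  "x \<in> carrier R \<Longrightarrow> y \<in> carrier R \<Longrightarrow>
    (I +>\<^bsub>R\<^esub> x) \<oplus>\<^bsub>quot_alg R I\<^esub> (I +>\<^bsub>R\<^esub> y) = I +>\<^bsub>R\<^esub> (x \<oplus>\<^bsub>R\<^esub> y)"
  by (simp add: quot_alg_simps FactRing_def I.a_rcos_sum)

lemma quot_one: "\<one>\<^bsub>quot_alg R I\<^esub> = I +>\<^bsub>R\<^esub> \<one>\<^bsub>R\<^esub>"
  by (simp add: quot_alg_simps FactRing_def)

lemma quot_zero: "\<zero>\<^bsub>quot_alg R I\<^esub> = I +>\<^bsub>R\<^esub> \<zero>\<^bsub>R\<^esub>"
  by (simp add: quot_alg_simps FactRing_def I.a_subset)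

text \<open>Since \<open>c \<odot> h\<close> is the product of \<open>c \<odot> \<one>\<close> with
  \<open>h\<close>, a ring ideal is automatically a subspace.\<close>

lemma ideal_smult: "h \<in> I \<Longrightarrow> c \<odot>\<^bsub>R\<^esub> h \<in> I"
  using I.I_l_closed[of h "c \<odot>\<^bsub>R\<^esub> \<one>\<^bsub>R\<^esub>"] I.a_Hcarr[of h] by (simp add: R.smult_mult_l)

lemma quot_coset_eqI:
  assumes "x \<in> carrier R" "y \<in> carrier R" "x \<ominus>\<^bsub>R\<^esub> y \<in> I"
  shows "I +>\<^bsub>R\<^esub> x = I +>\<^bsub>R\<^esub> y"
proof -
  have "x = (x \<ominus>\<^bsub>R\<^esub> y) \<oplus>\<^bsub>R\<^esub> y" using assms by (simp add: R.minus_eq R.a_assoc R.l_neg)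
  then have "x \<in> I +>\<^bsub>R\<^esub> y" using assms(3) unfolding a_r_coset_def' by blast
  then show ?thesis using I.a_repr_independence'[of x y] assms by simp
qed

text \<open>Two representatives differ by an element of \<open>I\<close>, and \<open>I\<close> is
  closed under scalars. So all cosets in the union that defines scalar multiplication
  coincide.\<close>

lemma quot_smult:
  assumes x: "x \<in> carrier R"
  shows "c \<odot>\<^bsub>quot_alg R I\<^esub> (I +>\<^bsub>R\<^esub> x) = I +>\<^bsub>R\<^esub> (c \<odot>\<^bsub>R\<^esub> x)"
proof -
  have "I +>\<^bsub>R\<^esub> (c \<odot>\<^bsub>R\<^esub> x') = I +>\<^bsub>R\<^esub> (c \<odot>\<^bsub>R\<^esub> x)" if "x' \<in> I +>\<^bsub>R\<^esub> x" for x'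
  proof -
    obtain h where h: "h \<in> I" "x' = h \<oplus>\<^bsub>R\<^esub> x" using \<open>x' \<in> _\<close> unfolding a_r_coset_def' by blast
    have "c \<odot>\<^bsub>R\<^esub> x' = c \<odot>\<^bsub>R\<^esub> h \<oplus>\<^bsub>R\<^esub> c \<odot>\<^bsub>R\<^esub> x"
      using h x I.a_Hcarr by (simp add: R.smult_r_distr)
    then have "c \<odot>\<^bsub>R\<^esub> x' \<in> I +>\<^bsub>R\<^esub> (c \<odot>\<^bsub>R\<^esub> x)"
      using ideal_smult[OF h(1)] unfolding a_r_coset_def' by blast
    then show ?thesis using I.a_repr_independence'[of "c \<odot>\<^bsub>R\<^esub> x'" "c \<odot>\<^bsub>R\<^esub> x"] x by simp
  qed
  moreover have "x \<in> I +>\<^bsub>R\<^esub> x" using x by (rule I.a_rcos_self)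
  ultimately show ?thesis unfolding quot_alg_simps by blast
qed

lemma k_algebra_quot_alg: "k_algebra (quot_alg R I)"
proof -
  interpret Q: ring "R Quot I" by (rule I.quotient_is_ring)
  \<comment> \<open>\<open>quot_alg R I\<close> has the operations of \<open>R Quot I\<close> but is
    a different record, so the ring axioms are transported one by one.\<close>
  have "ring (quot_alg R I)"
    by (intro ringI abelian_groupI monoidI)
      (auto simp: quot_alg_simps(1-5) Q.m_assoc Q.a_ac Q.l_distr Q.r_distr
        intro: Q.add.l_inv_ex[simplified])
  moreover have "k_algebra_axioms (quot_alg R I)"
    by unfold_locales
      (auto elim!: quot_cosetE simp: quot_smult quot_mult quot_add R.smult_l_distr R.smult_r_distr
        R.smult_smult R.smult_mult_l R.smult_mult_r)
  ultimately show ?thesis by (rule k_algebra.intro)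
qed

lemma coset_alg_hom: "(\<lambda>x. I +>\<^bsub>R\<^esub> x) \<in> alg_hom R (quot_alg R I)"
  by (rule alg_homI) (simp_all add: quot_smult quot_mult quot_add quot_one)

section \<open>Maps out of a quotient algebra\<close>

context
  fixes B :: "('k, 'b) module" and h :: "'a \<Rightarrow> 'b"
  assumes B: "k_algebra B" and null: "\<And>x. x \<in> I \<Longrightarrow> h x = \<zero>\<^bsub>B\<^esub>"
begin

interpretation B: k_algebra B by (rule B)

lemma quot_lift_coset:
  assumes h: "h \<in> lin_map R B" and x: "x \<in> carrier R"
  shows "quot_lift h (I +>\<^bsub>R\<^esub> x) = h x"
proof -
  have "h x' = h x" if x': "x' \<in> I +>\<^bsub>R\<^esub> x" for x'
  proof -
    obtain y where y: "y \<in> I" "x' = y \<oplus>\<^bsub>R\<^esub> x" using x' unfolding a_r_coset_def' by blast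
    then show ?thesis using lin_mapD[OF h] x null I.a_Hcarr by simp
  qed
  then have "h ` (I +>\<^bsub>R\<^esub> x) = {h x}" using I.a_rcos_self[OF x] by blast
  then show ?thesis by (simp add: quot_lift_def)
qed

lemma quot_lift_lin_map:
  assumes h: "h \<in> lin_map R B"
  shows "quot_lift h \<in> lin_map (quot_alg R I) B"
  by (rule lin_mapI)
    (auto elim!: quot_cosetE simp: quot_smult quot_mult quot_add quot_lift_coset[OF h] lin_mapD[OF h])

lemma quot_lift_alg_hom:
  assumes h: "h \<in> alg_hom R B"
  shows "quot_lift h \<in> alg_hom (quot_alg R I) B"
  by (rule alg_homI)
    (auto elim!: quot_cosetE simp: quot_smult quot_mult quot_add quot_one alg_homD[OF h]
      quot_lift_coset[OF alg_hom_lin_map[OF h]])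

end

end


section \<open>Tensor products of algebras\<close>

definition bilin :: "('k::field, 'a) module \<Rightarrow> ('k, 'b) module \<Rightarrow> ('k, 'c) module \<Rightarrow> ('a \<Rightarrow> 'b \<Rightarrow> 'c) \<Rightarrow> bool"
  where "bilin A B C \<beta> \<longleftrightarrow>
    (\<forall>x\<in>carrier A. \<beta> x \<in> lin_map B C) \<and> (\<forall>y\<in>carrier B. (\<lambda>x. \<beta> x y) \<in> lin_map A C)"

lemma bilinD:
  assumes "bilin A B C \<beta>"
  shows "x \<in> carrier A \<Longrightarrow> y \<in> carrier B \<Longrightarrow> \<beta> x y \<in> carrier C"
    and "x \<in> carrier A \<Longrightarrow> x' \<in> carrier A \<Longrightarrow> y \<in> carrier B \<Longrightarrow> \<beta> (x \<oplus>\<^bsub>A\<^esub> x') y = \<beta> x y \<oplus>\<^bsub>C\<^esub> \<beta> x' y"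
    and "x \<in> carrier A \<Longrightarrow> y \<in> carrier B \<Longrightarrow> y' \<in> carrier B \<Longrightarrow> \<beta> x (y \<oplus>\<^bsub>B\<^esub> y') = \<beta> x y \<oplus>\<^bsub>C\<^esub> \<beta> x y'"
    and "x \<in> carrier A \<Longrightarrow> y \<in> carrier B \<Longrightarrow> \<beta> (c \<odot>\<^bsub>A\<^esub> x) y = c \<odot>\<^bsub>C\<^esub> \<beta> x y"
    and "x \<in> carrier A \<Longrightarrow> y \<in> carrier B \<Longrightarrow> \<beta> x (c \<odot>\<^bsub>B\<^esub> y) = c \<odot>\<^bsub>C\<^esub> \<beta> x y"
  using assms by (auto simp: bilin_def lin_map_def)

lemma bilinI:
  assumes "\<And>x y. x \<in> carrier A \<Longrightarrow> y \<in> carrier B \<Longrightarrow> \<beta> x y \<in> carrier C"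
    and "\<And>x x' y. x \<in> carrier A \<Longrightarrow> x' \<in> carrier A \<Longrightarrow> y \<in> carrier B \<Longrightarrow> \<beta> (x \<oplus>\<^bsub>A\<^esub> x') y = \<beta> x y \<oplus>\<^bsub>C\<^esub> \<beta> x' y"
    and "\<And>x y y'. x \<in> carrier A \<Longrightarrow> y \<in> carrier B \<Longrightarrow> y' \<in> carrier B \<Longrightarrow> \<beta> x (y \<oplus>\<^bsub>B\<^esub> y') = \<beta> x y \<oplus>\<^bsub>C\<^esub> \<beta> x y'"
    and "\<And>x y c. x \<in> carrier A \<Longrightarrow> y \<in> carrier B \<Longrightarrow> \<beta> (c \<odot>\<^bsub>A\<^esub> x) y = c \<odot>\<^bsub>C\<^esub> \<beta> x y"
    and "\<And>x y c. x \<in> carrier A \<Longrightarrow> y \<in> carrier B \<Longrightarrow> \<beta> x (c \<odot>\<^bsub>B\<^esub> y) = c \<odot>\<^bsub>C\<^esub> \<beta> x y"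
  shows "bilin A B C \<beta>"
  using assms by (auto simp: bilin_def lin_map_def)

text \<open>Factors the lift into linear extension from the free vector space and descent to the
  quotient, so that the results on both can be reused.\<close>

lemma tensor_lift_conv_quot_lift:
  "tensor_lift C \<beta> = quot_lift (lin_ext C (\<lambda>u. \<beta> (fst u) (snd u)))"
  by (simp add: fun_eq_iff tensor_lift_def quot_lift_def lin_ext_def)

context
  fixes A :: "('k::field, 'a) module" and B :: "('k, 'b) module"
  assumes A: "k_algebra A" and B: "k_algebra B"
begin

interpretation A: k_algebra A by (rule A)
interpretation B: k_algebra B by (rule B)
interpretation M: k_algebra "monoid_alg (A \<times>\<times> B) :: ('k, _) module"
  by (intro k_algebra_monoid_alg DirProd_monoid A.monoid_axioms B.monoid_axioms)

lemma tensor_null_keys: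
  "p \<in> tensor_null A B \<Longrightarrow> Poly_Mapping.keys p \<subseteq> carrier A \<times> carrier B"
  by (induction rule: tensor_null.induct)
    (simp_all add: keys_diff_subset keys_add_subset keys_scale_subset keys_single_subset del: keys_single)

lemma tensor_null_minus: "p \<in> tensor_null A B \<Longrightarrow> - p \<in> tensor_null A B"
  using tensor_null.span_smult[of p A B "-1"]
  by (metis (no_types) lookup_scale lookup_uminus mult_minus1 poly_mapping_eqI)

lemma monoid_alg_mult_diff:
  fixes p r s :: "'g \<Rightarrow>\<^sub>0 'k"
  shows "s \<otimes>\<^bsub>monoid_alg G\<^esub> (p - r) = s \<otimes>\<^bsub>monoid_alg G\<^esub> p - s \<otimes>\<^bsub>monoid_alg G\<^esub> r"
    and "(p - r) \<otimes>\<^bsub>monoid_alg G\<^esub> s = p \<otimes>\<^bsub>monoid_alg G\<^esub> s - r \<otimes>\<^bsub>monoid_alg G\<^esub> s"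
  using monoid_alg_mult_add_right[of G s "p - r" r] monoid_alg_mult_add_left[of G "p - r" r s]
  by simp_all

text \<open>Multiplying a bilinearity relation by a basis element \<open>(a, b)\<close> gives a
  relation of the same shape, by distributivity and centrality of scalars in \<open>A\<close> and
  \<open>B\<close>.\<close>

lemma tensor_null_mult_single:
  assumes p: "p \<in> tensor_null A B" and u: "u \<in> carrier A \<times> carrier B"
  shows "Poly_Mapping.single u 1 \<otimes>\<^bsub>monoid_alg (A \<times>\<times> B)\<^esub> p \<in> tensor_null A B"
    and "p \<otimes>\<^bsub>monoid_alg (A \<times>\<times> B)\<^esub> Poly_Mapping.single u 1 \<in> tensor_null A B"
proof -
  obtain a b where [simp]: "u = (a, b)" "a \<in> carrier A" "b \<in> carrier B" using u by auto
  note mon = DirProd_monoid[OF A.monoid_axioms B.monoid_axioms]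
  have "Poly_Mapping.single u 1 \<otimes>\<^bsub>monoid_alg (A \<times>\<times> B)\<^esub> p \<in> tensor_null A B \<and>
        p \<otimes>\<^bsub>monoid_alg (A \<times>\<times> B)\<^esub> Poly_Mapping.single u 1 \<in> tensor_null A B"
    using p
  proof (induction rule: tensor_null.induct)
    case (span_smult p c)
    then show ?case using tensor_null_keys[of p]
      by (simp add: monoid_alg_scale_mult[OF mon] tensor_null.span_smult)
  qed (simp_all add: monoid_alg_mult_diff monoid_alg_mult_add_left monoid_alg_mult_add_right
      tensor_null.intros A.r_distr B.r_distr A.l_distr B.l_distr
      A.smult_mult_l A.smult_mult_r B.smult_mult_l B.smult_mult_r)
  then show "Poly_Mapping.single u 1 \<otimes>\<^bsub>monoid_alg (A \<times>\<times> B)\<^esub> p \<in> tensor_null A B"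
    and "p \<otimes>\<^bsub>monoid_alg (A \<times>\<times> B)\<^esub> Poly_Mapping.single u 1 \<in> tensor_null A B" by auto
qed

lemma ideal_tensor_null: "ideal (tensor_null A B) (monoid_alg (A \<times>\<times> B) :: ('k, _) module)"
proof -
  note mon = DirProd_monoid[OF A.monoid_axioms B.monoid_axioms]
  have "subgroup (tensor_null A B) (add_monoid (monoid_alg (A \<times>\<times> B) :: ('k, _) module))"
  proof (rule M.add.subgroupI)
    fix p :: "'a \<times> 'b \<Rightarrow>\<^sub>0 'k" assume p: "p \<in> tensor_null A B"
    have "\<ominus>\<^bsub>monoid_alg (A \<times>\<times> B)\<^esub> p = - p"
      using tensor_null_keys[OF p] tensor_null_keys[OF tensor_null_minus[OF p]]
      by (intro M.minus_equality) auto
    then show "\<ominus>\<^bsub>monoid_alg (A \<times>\<times> B)\<^esub> p \<in> tensor_null A B" using tensor_null_minus[OF p] by simp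
  qed (use tensor_null_keys tensor_null.span_zero tensor_null.span_add in \<open>fastforce+\<close>)
  moreover have "s \<otimes>\<^bsub>monoid_alg (A \<times>\<times> B)\<^esub> p \<in> tensor_null A B \<and> p \<otimes>\<^bsub>monoid_alg (A \<times>\<times> B)\<^esub> s \<in> tensor_null A B"
    if p: "p \<in> tensor_null A B" and s: "Poly_Mapping.keys s \<subseteq> carrier A \<times> carrier B"
    for s p :: "'a \<times> 'b \<Rightarrow>\<^sub>0 'k"
    using s
  proof (induction rule: pm_induct)
    case (add u c s)
    have "Poly_Mapping.keys (Poly_Mapping.single u (1::'k)) \<subseteq> carrier (A \<times>\<times> B)"
      using add(1) by auto
    \<comment> \<open>These equations pull \<open>c\<close> out of \<open>single u c\<close>, which
      leaves the basis element \<open>single u 1\<close> treated above.\<close>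
    note mult = monoid_alg_scale_mult[OF mon this, of p c] monoid_alg_scale_mult[OF mon _ this, of p c]
    have "Poly_Mapping.single u c \<otimes>\<^bsub>monoid_alg (A \<times>\<times> B)\<^esub> p \<in> tensor_null A B"
      "p \<otimes>\<^bsub>monoid_alg (A \<times>\<times> B)\<^esub> Poly_Mapping.single u c \<in> tensor_null A B"
      using tensor_null_mult_single[OF p add(1), THEN tensor_null.span_smult[where c = c]]
        tensor_null_keys[OF p] mult by simp_all
    with add show ?case
      by (simp add: monoid_alg_mult_add_left monoid_alg_mult_add_right tensor_null.span_add)
  qed (simp add: tensor_null.span_zero)
  ultimately show ?thesis
    by (intro idealI M.ring_axioms) simp_all
qed

lemma k_algebra_tensor_alg: "k_algebra (tensor_alg A B)"
  unfolding tensor_alg_def by (rule k_algebra_quot_alg[OF M.k_algebra_axioms ideal_tensor_null])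

interpretation T: k_algebra "tensor_alg A B" by (rule k_algebra_tensor_alg)

lemmas tensor_coset_closed = quot_coset_closed[OF M.k_algebra_axioms ideal_tensor_null, folded tensor_alg_def]
  and tensor_coset_mult = quot_mult[OF M.k_algebra_axioms ideal_tensor_null, folded tensor_alg_def]
  and tensor_coset_add = quot_add[OF M.k_algebra_axioms ideal_tensor_null, folded tensor_alg_def]
  and tensor_coset_smult = quot_smult[OF M.k_algebra_axioms ideal_tensor_null, folded tensor_alg_def]
  and tensor_coset_one = quot_one[OF M.k_algebra_axioms ideal_tensor_null, folded tensor_alg_def]
  and tensor_coset_zero = quot_zero[OF M.k_algebra_axioms ideal_tensor_null, folded tensor_alg_def]
  and tensor_coset_eqI = quot_coset_eqI[OF M.k_algebra_axioms ideal_tensor_null, folded tensor_alg_def]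

text \<open>Replaces the abstract difference in the ring \<open>monoid_alg\<close> by pointwise
  subtraction of finitely supported functions, the form in which the relations of
  \<open>tensor_null\<close> are given.\<close>

lemma tensor_coset_eq:
  fixes p r :: "'a \<times> 'b \<Rightarrow>\<^sub>0 'k"
  assumes "Poly_Mapping.keys p \<subseteq> carrier A \<times> carrier B" "Poly_Mapping.keys r \<subseteq> carrier A \<times> carrier B"
    "p - r \<in> tensor_null A B"
  shows "tensor_null A B +>\<^bsub>(monoid_alg (A \<times>\<times> B) :: ('k, _) module)\<^esub> p = tensor_null A B +>\<^bsub>monoid_alg (A \<times>\<times> B)\<^esub> r"
proof (rule tensor_coset_eqI)
  have "\<ominus>\<^bsub>monoid_alg (A \<times>\<times> B)\<^esub> r = - r"
    using assms(2) by (intro M.minus_equality) (auto simp: in_keys_iff)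
  then show "p \<ominus>\<^bsub>monoid_alg (A \<times>\<times> B)\<^esub> r \<in> tensor_null A B" using assms by (simp add: M.minus_eq)
qed (use assms in simp_all)

lemma pure_closed [simp]:
  "x \<in> carrier A \<Longrightarrow> y \<in> carrier B \<Longrightarrow> pure_tensor A B x y \<in> carrier (tensor_alg A B)"
  unfolding pure_tensor_def by (rule tensor_coset_closed) simp

lemma pure_mult:
  "\<lbrakk>x \<in> carrier A; y \<in> carrier B; x' \<in> carrier A; y' \<in> carrier B\<rbrakk> \<Longrightarrow>
    pure_tensor A B x y \<otimes>\<^bsub>tensor_alg A B\<^esub> pure_tensor A B x' y'
      = pure_tensor A B (x \<otimes>\<^bsub>A\<^esub> x') (y \<otimes>\<^bsub>B\<^esub> y')"
  unfolding pure_tensor_def by (subst tensor_coset_mult) auto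

lemma pure_one: "\<one>\<^bsub>tensor_alg A B\<^esub> = pure_tensor A B \<one>\<^bsub>A\<^esub> \<one>\<^bsub>B\<^esub>"
  unfolding pure_tensor_def by (subst tensor_coset_one) auto

lemma pure_bilin: "bilin A B (tensor_alg A B) (pure_tensor A B)"
proof (rule bilinI)
  fix x x' y assume [simp]: "x \<in> carrier A" "x' \<in> carrier A" "y \<in> carrier B"
  show "pure_tensor A B (x \<oplus>\<^bsub>A\<^esub> x') y = pure_tensor A B x y \<oplus>\<^bsub>tensor_alg A B\<^esub> pure_tensor A B x' y"
    unfolding pure_tensor_def
    using tensor_null.add_left[of x A x' y B]
    by (simp add: tensor_coset_add)
      (rule tensor_coset_eq, simp_all add: keys_add_subset keys_single_subset diff_diff_eq del: keys_single)
next
  fix x y y' assume [simp]: "x \<in> carrier A" "y \<in> carrier B" "y' \<in> carrier B"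
  show "pure_tensor A B x (y \<oplus>\<^bsub>B\<^esub> y') = pure_tensor A B x y \<oplus>\<^bsub>tensor_alg A B\<^esub> pure_tensor A B x y'"
    unfolding pure_tensor_def
    using tensor_null.add_right[of x A y B y']
    by (simp add: tensor_coset_add)
      (rule tensor_coset_eq, simp_all add: keys_add_subset keys_single_subset diff_diff_eq del: keys_single)
next
  fix x y c assume [simp]: "x \<in> carrier A" "y \<in> carrier B"
  show "pure_tensor A B (c \<odot>\<^bsub>A\<^esub> x) y = c \<odot>\<^bsub>tensor_alg A B\<^esub> pure_tensor A B x y"
    unfolding pure_tensor_def
    using tensor_null.smult_left[of x A y B c]
    by (simp add: tensor_coset_smult) (rule tensor_coset_eq, simp_all add: keys_single_subset del: keys_single)
  show "pure_tensor A B x (c \<odot>\<^bsub>B\<^esub> y) = c \<odot>\<^bsub>tensor_alg A B\<^esub> pure_tensor A B x y"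
    unfolding pure_tensor_def
    using tensor_null.smult_right[of x A y B c]
    by (simp add: tensor_coset_smult) (rule tensor_coset_eq, simp_all add: keys_single_subset del: keys_single)
qed simp

lemmas pure_simps = bilinD(2-5)[OF pure_bilin]

text \<open>Scalars can be absorbed into the left factor and zero is the pure tensor of two zeros.
  Pure tensors therefore generate the tensor product under addition alone.\<close>

lemma tensor_induct [consumes 1, case_names pure add]:
  assumes X: "X \<in> carrier (tensor_alg A B)"
    and pure: "\<And>x y. x \<in> carrier A \<Longrightarrow> y \<in> carrier B \<Longrightarrow> P (pure_tensor A B x y)"
    and add: "\<And>X Y. \<lbrakk>X \<in> carrier (tensor_alg A B); Y \<in> carrier (tensor_alg A B); P X; P Y\<rbrakk>
      \<Longrightarrow> P (X \<oplus>\<^bsub>tensor_alg A B\<^esub> Y)"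
  shows "P X"
proof -
  obtain p :: "'a \<times> 'b \<Rightarrow>\<^sub>0 'k" where p: "Poly_Mapping.keys p \<subseteq> carrier A \<times> carrier B"
    and Xp: "X = tensor_null A B +>\<^bsub>monoid_alg (A \<times>\<times> B)\<^esub> p"
    using quot_cosetE[OF M.k_algebra_axioms ideal_tensor_null X[unfolded tensor_alg_def]] by auto
  have "P (tensor_null A B +>\<^bsub>monoid_alg (A \<times>\<times> B)\<^esub> p)"
    using p
  proof (induction rule: pm_induct)
    case zero
    have "pure_tensor A B \<zero>\<^bsub>A\<^esub> \<zero>\<^bsub>B\<^esub> = \<zero>\<^bsub>tensor_alg A B\<^esub>"
      using pure_simps(3)[of "\<zero>\<^bsub>A\<^esub>" "\<zero>\<^bsub>B\<^esub>" 0] by simp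
    then show ?case using pure[of "\<zero>\<^bsub>A\<^esub>" "\<zero>\<^bsub>B\<^esub>"] tensor_coset_zero by simp
  next
    case (add u c p)
    then obtain x y where u: "u = (x, y)" "x \<in> carrier A" "y \<in> carrier B" by auto
    have "tensor_null A B +>\<^bsub>monoid_alg (A \<times>\<times> B)\<^esub> Poly_Mapping.single u c
        = c \<odot>\<^bsub>tensor_alg A B\<^esub> pure_tensor A B x y"
      using u unfolding pure_tensor_def by (subst tensor_coset_smult) auto
    also have "\<dots> = pure_tensor A B (c \<odot>\<^bsub>A\<^esub> x) y" using u by (simp add: pure_simps)
    finally have "P (tensor_null A B +>\<^bsub>monoid_alg (A \<times>\<times> B)\<^esub> Poly_Mapping.single u c)"
      using u by (simp add: pure)
    then have "P ((tensor_null A B +>\<^bsub>monoid_alg (A \<times>\<times> B)\<^esub> Poly_Mapping.single u c) \<oplus>\<^bsub>tensor_alg A B\<^esub>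
        (tensor_null A B +>\<^bsub>monoid_alg (A \<times>\<times> B)\<^esub> p))"
      using add u by (intro assms(3) tensor_coset_closed) (auto simp: keys_single_subset simp del: keys_single)
    then show ?case
      using add u by (subst (asm) tensor_coset_add) (auto simp: keys_single_subset simp del: keys_single)
  qed
  then show ?thesis by (simp add: Xp)
qed

section \<open>Universal property of the tensor product\<close>

context
  fixes C :: "('k, 'c) module" and \<beta> :: "'a \<Rightarrow> 'b \<Rightarrow> 'c"
  assumes C: "k_algebra C" and \<beta>: "bilin A B C \<beta>"
begin

interpretation C: k_algebra C by (rule C)

lemma tensor_lift_ext: "(\<lambda>u. \<beta> (fst u) (snd u)) \<in> carrier (A \<times>\<times> B) \<rightarrow> carrier C"
  using bilinD(1)[OF \<beta>] by auto

text \<open>On each generating relation the extension yields a difference that cancels by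
  bilinearity of \<open>\<beta>\<close>; linearity handles the span.\<close>

lemma tensor_lift_null:
  assumes "p \<in> tensor_null A B"
  shows "lin_ext C (\<lambda>u. \<beta> (fst u) (snd u)) p = \<zero>\<^bsub>C\<^esub>"
proof -
  note f = tensor_lift_ext[simplified]
  note [simp] = C.lin_ext_single C.lin_ext_diff[OF f] C.lin_ext_add[OF f] C.lin_ext_scale[OF f]
    tensor_null_keys bilinD[OF \<beta>]
    keys_diff_subset keys_add_subset keys_scale_subset keys_single_subset
  show ?thesis
    using assms
  proof (induction rule: tensor_null.induct)
    case (add_left x y z)
    then have "\<beta> x z \<oplus>\<^bsub>C\<^esub> \<beta> y z \<ominus>\<^bsub>C\<^esub> \<beta> x z \<ominus>\<^bsub>C\<^esub> \<beta> y z = \<zero>\<^bsub>C\<^esub>"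
      using bilinD(1)[OF \<beta>] C.r_neg[of "\<beta> x z \<oplus>\<^bsub>C\<^esub> \<beta> y z"]
      by (simp add: C.minus_eq C.minus_add C.a_assoc)
    with add_left show ?case by (simp del: keys_single)
  next
    case (add_right x y z)
    then have "\<beta> x y \<oplus>\<^bsub>C\<^esub> \<beta> x z \<ominus>\<^bsub>C\<^esub> \<beta> x y \<ominus>\<^bsub>C\<^esub> \<beta> x z = \<zero>\<^bsub>C\<^esub>"
      using bilinD(1)[OF \<beta>] C.r_neg[of "\<beta> x y \<oplus>\<^bsub>C\<^esub> \<beta> x z"]
      by (simp add: C.minus_eq C.minus_add C.a_assoc)
    with add_right show ?case by (simp del: keys_single)
  qed (simp_all add: C.minus_eq C.r_neg del: keys_single)
qed

lemma tensor_lift_pure: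
  assumes "x \<in> carrier A" "y \<in> carrier B"
  shows "tensor_lift C \<beta> (pure_tensor A B x y) = \<beta> x y"
proof -
  have "tensor_lift C \<beta> (pure_tensor A B x y) = lin_ext C (\<lambda>u. \<beta> (fst u) (snd u)) (Poly_Mapping.single (x, y) 1)"
    unfolding pure_tensor_def tensor_lift_conv_quot_lift
    by (rule quot_lift_coset[OF M.k_algebra_axioms ideal_tensor_null C])
      (use assms tensor_lift_null lin_ext_lin_map[OF C tensor_lift_ext] in auto)
  then show ?thesis using assms bilinD(1)[OF \<beta>] by (simp add: C.lin_ext_single)
qed

lemma tensor_lift_lin_map: "tensor_lift C \<beta> \<in> lin_map (tensor_alg A B) C"
  unfolding tensor_lift_conv_quot_lift tensor_alg_def
  by (rule quot_lift_lin_map[OF M.k_algebra_axioms ideal_tensor_null C])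
    (use tensor_lift_null lin_ext_lin_map[OF C tensor_lift_ext] in auto)

text \<open>Pairs are the monoid basis of the free vector space, so multiplicativity of
  \<open>\<beta>\<close> on pairs gives an algebra homomorphism there, and it descends to the
  quotient.\<close>

lemma tensor_lift_alg_hom:
  assumes mult: "\<And>x y x' y'. \<lbrakk>x \<in> carrier A; y \<in> carrier B; x' \<in> carrier A; y' \<in> carrier B\<rbrakk> \<Longrightarrow>
      \<beta> (x \<otimes>\<^bsub>A\<^esub> x') (y \<otimes>\<^bsub>B\<^esub> y') = \<beta> x y \<otimes>\<^bsub>C\<^esub> \<beta> x' y'"
    and one: "\<beta> \<one>\<^bsub>A\<^esub> \<one>\<^bsub>B\<^esub> = \<one>\<^bsub>C\<^esub>"
  shows "tensor_lift C \<beta> \<in> alg_hom (tensor_alg A B) C"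
proof -
  have "lin_ext C (\<lambda>u. \<beta> (fst u) (snd u)) \<in> alg_hom (monoid_alg (A \<times>\<times> B) :: ('k, _) module) C"
    by (rule lin_ext_alg_hom[OF DirProd_monoid[OF A.monoid_axioms B.monoid_axioms] C tensor_lift_ext])
      (auto simp: mult one)
  then show ?thesis
    unfolding tensor_lift_conv_quot_lift tensor_alg_def
    by (intro quot_lift_alg_hom[OF M.k_algebra_axioms ideal_tensor_null C]) (simp_all add: tensor_lift_null)
qed

end

lemma cring_tensor_alg:
  assumes "cring A" "cring B"
  shows "cring (tensor_alg A B)"
proof (intro cringI T.abelian_group_axioms T.l_distr comm_monoidI)
  interpret A': cring A by fact
  interpret B': cring B by fact
  fix X Y assume X: "X \<in> carrier (tensor_alg A B)" and Y: "Y \<in> carrier (tensor_alg A B)"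
  show "X \<otimes>\<^bsub>tensor_alg A B\<^esub> Y = Y \<otimes>\<^bsub>tensor_alg A B\<^esub> X"
    using X
  proof (induction rule: tensor_induct)
    case (pure x y)
    show ?case
      using Y
      by (induction rule: tensor_induct)
        (simp_all add: pure pure_mult A'.m_comm B'.m_comm T.l_distr T.r_distr)
  qed (simp add: T.l_distr T.r_distr Y)
qed (simp_all add: T.m_assoc)

end


section \<open>Presentation of the quantum complete intersection\<close>

lemma alg_hom_pow:
  assumes "k_algebra A" "k_algebra B" "f \<in> alg_hom A B" "x \<in> carrier A"
  shows "f (x [^]\<^bsub>A\<^esub> (m::nat)) = f x [^]\<^bsub>B\<^esub> m"
  using ring_hom_ring.hom_nat_pow[OF alg_hom_ring_hom_ring[OF assms(1-3)] assms(4)] .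

lemma monoid_words: "monoid \<lparr>carrier = lists S, mult = (@), one = []\<rparr>"
  by (rule monoidI) auto

lemma k_algebra_free_alg: "k_algebra (free_alg n :: ('k::field, _) module)"
  unfolding free_alg_def by (rule k_algebra_monoid_alg[OF monoid_words])

lemma free_gen_closed: "i \<in> {1..n} \<Longrightarrow> free_gen i \<in> carrier (free_alg n)"
  by (simp add: free_alg_def free_gen_def)

section \<open>Universal property of the free algebra\<close>

definition word_prod :: "('k::field, 'b) module \<Rightarrow> (nat \<Rightarrow> 'b) \<Rightarrow> nat list \<Rightarrow> 'b" where
  "word_prod B b w = foldr (\<lambda>i x. b i \<otimes>\<^bsub>B\<^esub> x) w \<one>\<^bsub>B\<^esub>"

context
  fixes B :: "('k::field, 'b) module" and b :: "nat \<Rightarrow> 'b" and n :: nat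
  assumes B: "k_algebra B" and b: "\<And>i. i \<in> {1..n} \<Longrightarrow> b i \<in> carrier B"
begin

interpretation B: k_algebra B by (rule B)

lemma word_prod_closed: "w \<in> lists {1..n} \<Longrightarrow> word_prod B b w \<in> carrier B"
  by (induction w) (simp_all add: word_prod_def b)

lemma word_prod_append:
  "v \<in> lists {1..n} \<Longrightarrow> w \<in> lists {1..n} \<Longrightarrow>
    word_prod B b (v @ w) = word_prod B b v \<otimes>\<^bsub>B\<^esub> word_prod B b w"
proof (induction v)
  case (Cons i v)
  then show ?case
    using word_prod_closed[of v] word_prod_closed[of w] by (simp add: word_prod_def b B.m_assoc)
qed (use word_prod_closed[of w] in \<open>simp add: word_prod_def\<close>)

lemma free_lift_alg_hom: "lin_ext B (word_prod B b) \<in> alg_hom (free_alg n) B"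
  unfolding free_alg_def
  by (rule lin_ext_alg_hom[OF monoid_words B])
    (use word_prod_closed word_prod_append in \<open>auto simp: word_prod_def\<close>)

lemma free_lift_gen: "i \<in> {1..n} \<Longrightarrow> lin_ext B (word_prod B b) (free_gen i) = b i"
  using b[of i] by (simp add: free_gen_def B.lin_ext_single word_prod_def)

end

definition qci_gen ::
  "nat \<Rightarrow> (nat \<Rightarrow> nat \<Rightarrow> 'k::field) \<Rightarrow> (nat \<Rightarrow> nat) \<Rightarrow> nat \<Rightarrow> (nat list \<Rightarrow>\<^sub>0 'k) set" where
  "qci_gen n q a i = Idl\<^bsub>(free_alg n :: ('k, _) module)\<^esub> (qci_rels n q a) +>\<^bsub>(free_alg n :: ('k, _) module)\<^esub> free_gen i"

context
  fixes n :: nat and q :: "nat \<Rightarrow> nat \<Rightarrow> 'k::field" and a :: "nat \<Rightarrow> nat"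
begin

interpretation F: k_algebra "free_alg n :: ('k, _) module" by (rule k_algebra_free_alg)

lemma qci_rels_subset: "qci_rels n q a \<subseteq> carrier (free_alg n)"
  unfolding qci_rels_def using free_gen_closed by auto

lemma ideal_qci: "ideal (Idl\<^bsub>(free_alg n :: ('k, _) module)\<^esub> (qci_rels n q a)) (free_alg n)"
  by (rule F.genideal_ideal[OF qci_rels_subset])

lemma k_algebra_qci: "k_algebra (qci n q a)"
  unfolding qci_def by (rule k_algebra_quot_alg[OF F.k_algebra_axioms ideal_qci])

interpretation A: k_algebra "qci n q a" by (rule k_algebra_qci)

lemmas coset_qci = coset_alg_hom[OF F.k_algebra_axioms ideal_qci, folded qci_def]

lemma qci_gen_closed: "i \<in> {1..n} \<Longrightarrow> qci_gen n q a i \<in> carrier (qci n q a)"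
  using alg_homD(1)[OF coset_qci free_gen_closed] by (simp add: qci_gen_def)

lemma qci_rel_zero:
  assumes "r \<in> qci_rels n q a"
  shows "Idl\<^bsub>(free_alg n :: ('k, _) module)\<^esub> (qci_rels n q a) +>\<^bsub>(free_alg n :: ('k, _) module)\<^esub> r = \<zero>\<^bsub>qci n q a\<^esub>"
proof -
  interpret I: ideal "Idl\<^bsub>(free_alg n :: ('k, _) module)\<^esub> (qci_rels n q a)" "free_alg n" by (rule ideal_qci)
  have "r \<in> Idl\<^bsub>(free_alg n :: ('k, _) module)\<^esub> (qci_rels n q a)"
    using F.genideal_self[OF qci_rels_subset] assms by blast
  then show ?thesis
    unfolding qci_def quot_alg_simps FactRing_def by (simp add: I.a_rcos_const)
qed

lemma qci_gen_pow: "i \<in> {1..n} \<Longrightarrow> qci_gen n q a i [^]\<^bsub>qci n q a\<^esub> a i = \<zero>\<^bsub>qci n q a\<^esub>"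
  using alg_hom_pow[OF F.k_algebra_axioms k_algebra_qci coset_qci free_gen_closed[of i], of "a i"]
    qci_rel_zero[of "free_gen i [^]\<^bsub>(free_alg n :: ('k, _) module)\<^esub> a i"]
  by (auto simp: qci_gen_def qci_rels_def)

lemma qci_gen_commute:
  assumes i: "i \<in> {1..n}" and j: "j \<in> {1..n}"
  shows "qci_gen n q a i \<otimes>\<^bsub>qci n q a\<^esub> qci_gen n q a j \<oplus>\<^bsub>qci n q a\<^esub>
    q i j \<odot>\<^bsub>qci n q a\<^esub> (qci_gen n q a j \<otimes>\<^bsub>qci n q a\<^esub> qci_gen n q a i) = \<zero>\<^bsub>qci n q a\<^esub>"
proof -
  note [simp] = free_gen_closed[OF i] free_gen_closed[OF j]
  have "free_gen i \<otimes>\<^bsub>free_alg n\<^esub> free_gen j \<oplus>\<^bsub>free_alg n\<^esub>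
      q i j \<odot>\<^bsub>free_alg n\<^esub> (free_gen j \<otimes>\<^bsub>free_alg n\<^esub> free_gen i) \<in> qci_rels n q a"
    using i j unfolding qci_rels_def by blast
  from qci_rel_zero[OF this] show ?thesis
    by (simp add: qci_gen_def alg_homD[OF coset_qci])
qed

text \<open>Universal property of the presentation: the kernel of the map from the free algebra is
  an ideal containing the relations, hence it contains the ideal they generate.\<close>

lemma qci_lift:
  fixes B :: "('k, 'b) module"
  assumes B: "k_algebra B" and b: "\<And>i. i \<in> {1..n} \<Longrightarrow> b i \<in> carrier B"
    and pow: "\<And>i. i \<in> {1..n} \<Longrightarrow> b i [^]\<^bsub>B\<^esub> a i = \<zero>\<^bsub>B\<^esub>"
    and comm: "\<And>i j. i \<in> {1..n} \<Longrightarrow> j \<in> {1..n} \<Longrightarrow>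
      b i \<otimes>\<^bsub>B\<^esub> b j \<oplus>\<^bsub>B\<^esub> q i j \<odot>\<^bsub>B\<^esub> (b j \<otimes>\<^bsub>B\<^esub> b i) = \<zero>\<^bsub>B\<^esub>"
  obtains f where "f \<in> alg_hom (qci n q a) B" "\<And>i. i \<in> {1..n} \<Longrightarrow> f (qci_gen n q a i) = b i"
proof -
  define h where "h = lin_ext B (word_prod B b)"
  have h: "h \<in> alg_hom (free_alg n) B" and hgen: "\<And>i. i \<in> {1..n} \<Longrightarrow> h (free_gen i) = b i"
    using free_lift_alg_hom[where b = b and n = n, OF B b] free_lift_gen[where b = b and n = n, OF B b]
    by (auto simp: h_def)
  interpret h: ring_hom_ring "free_alg n" B h
    by (rule alg_hom_ring_hom_ring[OF F.k_algebra_axioms B h])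
  have "h r = \<zero>\<^bsub>B\<^esub>" if "r \<in> qci_rels n q a" for r
    using that unfolding qci_rels_def
  proof (elim UnE CollectE exE conjE)
    fix i assume i: "i \<in> {1..n}" and r: "r = free_gen i [^]\<^bsub>(free_alg n :: ('k, _) module)\<^esub> a i"
    show ?thesis
      unfolding r alg_hom_pow[OF F.k_algebra_axioms B h free_gen_closed[OF i]] hgen[OF i] by (rule pow[OF i])
  next
    fix i j assume ij: "i \<in> {1..n}" "j \<in> {1..n}"
      and r: "r = free_gen i \<otimes>\<^bsub>free_alg n\<^esub> free_gen j \<oplus>\<^bsub>free_alg n\<^esub>
        q i j \<odot>\<^bsub>free_alg n\<^esub> (free_gen j \<otimes>\<^bsub>free_alg n\<^esub> free_gen i)"
    note [simp] = ij[THEN free_gen_closed] ij[THEN hgen]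
    show ?thesis unfolding r using comm[OF ij] by (simp add: alg_homD[OF h])
  qed
  then have "qci_rels n q a \<subseteq> a_kernel (free_alg n) B h"
    using subsetD[OF qci_rels_subset] unfolding a_kernel_def' by blast
  then have "Idl\<^bsub>(free_alg n :: ('k, _) module)\<^esub> (qci_rels n q a) \<subseteq> a_kernel (free_alg n) B h"
    by (intro F.genideal_minimal h.kernel_is_ideal)
  then have null: "h x = \<zero>\<^bsub>B\<^esub>" if "x \<in> Idl\<^bsub>(free_alg n :: ('k, _) module)\<^esub> (qci_rels n q a)" for x
    using that unfolding a_kernel_def' by blast
  show thesis
  proof
    show "quot_lift h \<in> alg_hom (qci n q a) B"
      unfolding qci_def by (rule quot_lift_alg_hom[OF F.k_algebra_axioms ideal_qci B null h])
    show "quot_lift h (qci_gen n q a i) = b i" if "i \<in> {1..n}" for i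
      unfolding qci_gen_def
      using quot_lift_coset[OF F.k_algebra_axioms ideal_qci B null alg_hom_lin_map[OF h] free_gen_closed[OF that]]
        hgen[OF that] by simp
  qed
qed

text \<open>Every element is the class of a linear combination of words, and each word arises from
  \<open>\<one>\<close> by multiplying with generators on the left. Zero is covered as the scalar
  multiple \<open>0 \<odot> \<one>\<close>.\<close>

lemma qci_induct [consumes 1, case_names one add smult gen]:
  assumes X: "X \<in> carrier (qci n q a)"
    and one: "P \<one>\<^bsub>qci n q a\<^esub>"
    and add: "\<And>X Y. \<lbrakk>X \<in> carrier (qci n q a); Y \<in> carrier (qci n q a); P X; P Y\<rbrakk> \<Longrightarrow> P (X \<oplus>\<^bsub>qci n q a\<^esub> Y)"
    and smult: "\<And>c X. \<lbrakk>X \<in> carrier (qci n q a); P X\<rbrakk> \<Longrightarrow> P (c \<odot>\<^bsub>qci n q a\<^esub> X)"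
    and gen: "\<And>i X. \<lbrakk>i \<in> {1..n}; X \<in> carrier (qci n q a); P X\<rbrakk> \<Longrightarrow>
      P (qci_gen n q a i \<otimes>\<^bsub>qci n q a\<^esub> X)"
  shows "P X"
proof -
  let ?c = "\<lambda>p. Idl\<^bsub>(free_alg n :: ('k, _) module)\<^esub> (qci_rels n q a) +>\<^bsub>(free_alg n :: ('k, _) module)\<^esub> p"
  note hom = alg_homD[OF coset_qci]
  have carr: "p \<in> carrier (free_alg n) \<longleftrightarrow> Poly_Mapping.keys p \<subseteq> lists {1..n}" for p :: "nat list \<Rightarrow>\<^sub>0 'k"
    by (simp add: free_alg_def)
  obtain p where p: "p \<in> carrier (free_alg n)" and Xp: "X = ?c p"
    using quot_cosetE[OF F.k_algebra_axioms ideal_qci X[unfolded qci_def]] by blast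
  have word: "P (?c (Poly_Mapping.single w 1)) \<and> Poly_Mapping.single w (1::'k) \<in> carrier (free_alg n)"
    if "w \<in> lists {1..n}" for w
    using that
  proof (induction w)
    case Nil
    have "\<one>\<^bsub>(free_alg n :: ('k, _) module)\<^esub> = Poly_Mapping.single [] 1" by (simp add: free_alg_def)
    then show ?case using one hom(4) by (simp add: free_alg_def)
  next
    case (Cons i w)
    have "Poly_Mapping.single (i # w) (1::'k) = free_gen i \<otimes>\<^bsub>free_alg n\<^esub> Poly_Mapping.single w 1"
      by (simp add: free_alg_def free_gen_def)
    then have "?c (Poly_Mapping.single (i # w) 1)
        = qci_gen n q a i \<otimes>\<^bsub>qci n q a\<^esub> ?c (Poly_Mapping.single w 1)"
      using Cons hom(2)[OF free_gen_closed[of i n]] by (simp add: qci_gen_def)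
    then show ?case using Cons gen hom(1) by (simp add: carr)
  qed
  have "P (?c p)"
    using p[unfolded carr]
  proof (induction rule: pm_induct)
    case zero
    have "?c (0 \<odot>\<^bsub>free_alg n\<^esub> \<one>\<^bsub>free_alg n\<^esub>) = 0 \<odot>\<^bsub>qci n q a\<^esub> \<one>\<^bsub>qci n q a\<^esub>"
      by (subst hom(5)) (simp_all only: hom(4) F.one_closed)
    then show ?case using smult[OF A.one_closed one, of 0] by (simp add: free_alg_def)
  next
    case (add w c p)
    have single: "Poly_Mapping.single w c = c \<odot>\<^bsub>free_alg n\<^esub> Poly_Mapping.single w 1"
      by (simp add: free_alg_def)
    have closed: "Poly_Mapping.single w (1::'k) \<in> carrier (free_alg n)" "P (?c (Poly_Mapping.single w 1))"
      using word[OF add(1)] by auto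
    have "?c (Poly_Mapping.single w c \<oplus>\<^bsub>free_alg n\<^esub> p)
        = c \<odot>\<^bsub>qci n q a\<^esub> ?c (Poly_Mapping.single w 1) \<oplus>\<^bsub>qci n q a\<^esub> ?c p"
      using closed carr[THEN iffD2, OF add(2)] unfolding single by (simp add: hom)
    moreover have "P (c \<odot>\<^bsub>qci n q a\<^esub> ?c (Poly_Mapping.single w 1) \<oplus>\<^bsub>qci n q a\<^esub> ?c p)"
      using add closed by (intro assms(3) smult A.smult_closed hom(1)) (auto simp: carr)
    ultimately show ?case by (simp add: free_alg_def)
  qed
  then show ?thesis by (simp add: Xp)
qed

text \<open>The uniqueness half of the universal property. Through it every bialgebra and antipode
  axiom below is verified on generators only.\<close>

lemma alg_hom_qci_eqI:
  assumes f: "f \<in> alg_hom (qci n q a) B" and g: "g \<in> alg_hom (qci n q a) B"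
    and gen: "\<And>i. i \<in> {1..n} \<Longrightarrow> f (qci_gen n q a i) = g (qci_gen n q a i)"
    and X: "X \<in> carrier (qci n q a)"
  shows "f X = g X"
  using X
  by (induction rule: qci_induct) (simp_all add: alg_homD[OF f] alg_homD[OF g] gen qci_gen_closed)

text \<open>With all \<open>q i j = -1\<close> the relations say that generators commute with each
  other. One induction makes each generator central, and a second one makes every element
  central.\<close>

lemma cring_qci:
  assumes q: "\<And>i j. i \<in> {1..n} \<Longrightarrow> j \<in> {1..n} \<Longrightarrow> q i j = -1"
  shows "cring (qci n q a)"
proof (intro cringI A.abelian_group_axioms A.l_distr comm_monoidI)
  have gens: "qci_gen n q a i \<otimes>\<^bsub>qci n q a\<^esub> qci_gen n q a j = qci_gen n q a j \<otimes>\<^bsub>qci n q a\<^esub> qci_gen n q a i"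
    if ij: "i \<in> {1..n}" "j \<in> {1..n}" for i j
  proof -
    note [simp] = qci_gen_closed[OF ij(1)] qci_gen_closed[OF ij(2)]
    have "qci_gen n q a i \<otimes>\<^bsub>qci n q a\<^esub> qci_gen n q a j
        \<ominus>\<^bsub>qci n q a\<^esub> qci_gen n q a j \<otimes>\<^bsub>qci n q a\<^esub> qci_gen n q a i = \<zero>\<^bsub>qci n q a\<^esub>"
      using qci_gen_commute[OF ij] unfolding q[OF ij] by (simp add: A.smult_minus_one A.minus_eq)
    then have "\<ominus>\<^bsub>qci n q a\<^esub> (\<ominus>\<^bsub>qci n q a\<^esub> (qci_gen n q a j \<otimes>\<^bsub>qci n q a\<^esub> qci_gen n q a i))
        = qci_gen n q a i \<otimes>\<^bsub>qci n q a\<^esub> qci_gen n q a j"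
      by (intro A.minus_equality) (simp_all add: A.minus_eq)
    then show ?thesis by simp
  qed
  have gen_comm: "X \<otimes>\<^bsub>qci n q a\<^esub> qci_gen n q a i = qci_gen n q a i \<otimes>\<^bsub>qci n q a\<^esub> X"
    if i: "i \<in> {1..n}" and X: "X \<in> carrier (qci n q a)" for i X
    using X
  proof (induction rule: qci_induct)
    case (gen j X)
    note [simp] = qci_gen_closed[OF i] qci_gen_closed[OF gen(1)]
    have "(qci_gen n q a j \<otimes>\<^bsub>qci n q a\<^esub> X) \<otimes>\<^bsub>qci n q a\<^esub> qci_gen n q a i
        = (qci_gen n q a j \<otimes>\<^bsub>qci n q a\<^esub> qci_gen n q a i) \<otimes>\<^bsub>qci n q a\<^esub> X"
      using gen by (simp add: A.m_assoc)
    also have "\<dots> = qci_gen n q a i \<otimes>\<^bsub>qci n q a\<^esub> (qci_gen n q a j \<otimes>\<^bsub>qci n q a\<^esub> X)"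
      using gen by (simp add: gens[OF gen(1) i] A.m_assoc)
    finally show ?case .
  qed (simp_all add: qci_gen_closed[OF i] A.l_distr A.r_distr A.smult_mult_l A.smult_mult_r)
  fix X Y assume X: "X \<in> carrier (qci n q a)" and Y: "Y \<in> carrier (qci n q a)"
  show "X \<otimes>\<^bsub>qci n q a\<^esub> Y = Y \<otimes>\<^bsub>qci n q a\<^esub> X"
    using X
  proof (induction rule: qci_induct)
    case (gen i X)
    note [simp] = qci_gen_closed[OF gen(1)] Y
    have "(qci_gen n q a i \<otimes>\<^bsub>qci n q a\<^esub> X) \<otimes>\<^bsub>qci n q a\<^esub> Y
        = (qci_gen n q a i \<otimes>\<^bsub>qci n q a\<^esub> Y) \<otimes>\<^bsub>qci n q a\<^esub> X"
      using gen by (simp add: A.m_assoc)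
    also have "\<dots> = Y \<otimes>\<^bsub>qci n q a\<^esub> (qci_gen n q a i \<otimes>\<^bsub>qci n q a\<^esub> X)"
      using gen by (simp add: gen_comm[OF gen(1) Y, symmetric] A.m_assoc)
    finally show ?case .
  qed (simp_all add: Y A.l_distr A.r_distr A.smult_mult_l A.smult_mult_r)
qed (simp_all add: A.m_assoc)

end


section \<open>Two quotients with known coefficients\<close>

text \<open>\<open>k[X]/(X\<^sup>m)\<close>, with every class represented by its element of degree less than \<open>m\<close>.\<close>

definition trunc_alg :: "nat \<Rightarrow> ('k::field, 'k fps) module" where
  "trunc_alg m = \<lparr>carrier = {f. \<forall>r\<ge>m. fps_nth f r = 0}, mult = (\<lambda>f g. fps_cutoff m (f * g)),
    one = fps_cutoff m 1, zero = 0, add = (+), smult = (\<lambda>c f. fps_const c * f)\<rparr>"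

text \<open>Coefficients of a product below \<open>m\<close> depend only on the coefficients of the
  factors below \<open>m\<close>. This is what makes the truncated product associative.\<close>

lemma fps_cutoff_mult:
  fixes f g :: "'k::field fps"
  shows "fps_cutoff m (fps_cutoff m f * g) = fps_cutoff m (f * g)"
    and "fps_cutoff m (f * fps_cutoff m g) = fps_cutoff m (f * g)"
  by (auto simp: fps_eq_iff fps_mult_nth intro!: sum.cong)

lemma fps_cutoff_id: "(\<forall>r\<ge>m. fps_nth f r = 0) \<Longrightarrow> fps_cutoff m f = f"
  by (auto simp: fps_eq_iff)

lemma fps_cutoff_const_mult:
  fixes f g :: "'k::field fps"
  shows "fps_cutoff m (fps_const c * f * g) = fps_const c * fps_cutoff m (f * g)"
    and "fps_cutoff m (f * fps_const c * g) = fps_const c * fps_cutoff m (f * g)"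
  by (simp_all add: fps_eq_iff mult.assoc mult.left_commute[of f "fps_const c"])

lemma k_algebra_trunc_alg: "k_algebra (trunc_alg m :: ('k::field, _) module)"
proof -
  have "ring (trunc_alg m :: ('k, _) module)"
  proof (intro ringI abelian_groupI monoidI)
    fix f :: "'k fps" assume "f \<in> carrier (trunc_alg m)"
    then show "\<exists>g\<in>carrier (trunc_alg m). g \<oplus>\<^bsub>trunc_alg m\<^esub> f = \<zero>\<^bsub>trunc_alg m\<^esub>"
      by (intro bexI[of _ "- f"]) (auto simp: trunc_alg_def)
  qed (auto simp: trunc_alg_def fps_cutoff_mult fps_cutoff_id algebra_simps fps_cutoff_add)
  then show ?thesis
    by (intro k_algebra.intro k_algebra_axioms.intro)
      (simp_all add: trunc_alg_def fps_cutoff_const_mult distrib_left distrib_right flip: mult.assoc fps_const_add)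
qed

lemma trunc_alg_pow: "f [^]\<^bsub>trunc_alg m\<^esub> (j::nat) = fps_cutoff m ((f::'k::field fps) ^ j)"
  by (induction j) (simp_all add: nat_pow_def trunc_alg_def fps_cutoff_mult mult.commute)

text \<open>The bound \<open>r < m\<close> stays below the degree where products and the unit are
  cut off; addition and scalar multiplication involve no truncation.\<close>

lemma trunc_alg_hom_nth:
  assumes h: "h \<in> alg_hom A (trunc_alg m)"
  shows "x \<in> carrier A \<Longrightarrow> y \<in> carrier A \<Longrightarrow> r < m \<Longrightarrow>
      fps_nth (h (x \<otimes>\<^bsub>A\<^esub> y)) r = (\<Sum>k\<le>r. fps_nth (h x) k * fps_nth (h y) (r - k))"
    and "x \<in> carrier A \<Longrightarrow> y \<in> carrier A \<Longrightarrow> fps_nth (h (x \<oplus>\<^bsub>A\<^esub> y)) r = fps_nth (h x) r + fps_nth (h y) r"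
    and "x \<in> carrier A \<Longrightarrow> fps_nth (h (c \<odot>\<^bsub>A\<^esub> x)) r = c * fps_nth (h x) r"
    and "r < m \<Longrightarrow> fps_nth (h \<one>\<^bsub>A\<^esub>) r = (if r = 0 then 1 else 0)"
  using alg_homD[OF h] by (simp_all add: trunc_alg_def) (simp add: fps_mult_nth atLeast0AtMost)

text \<open>The algebra generated by \<open>x\<close> and \<open>y\<close> with \<open>x\<^sup>2 = y\<^sup>2 = 0\<close> and \<open>y x = t x y\<close>, in the basis
  \<open>1, x, y, x y\<close>.\<close>

definition qplane_alg :: "'k::field \<Rightarrow> ('k, 'k \<times> 'k \<times> 'k \<times> 'k) module" where
  "qplane_alg t = \<lparr>carrier = UNIV,
    mult = (\<lambda>(a, b, c, d) (a', b', c', d').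
      (a * a', a * b' + b * a', a * c' + c * a', a * d' + d * a' + b * c' + t * c * b')),
    one = (1, 0, 0, 0), zero = (0, 0, 0, 0),
    add = (\<lambda>(a, b, c, d) (a', b', c', d'). (a + a', b + b', c + c', d + d')),
    smult = (\<lambda>s (a, b, c, d). (s * a, s * b, s * c, s * d))\<rparr>"

lemma k_algebra_qplane_alg: "k_algebra (qplane_alg (t::'k::field))"
proof -
  have "ring (qplane_alg t)"
  proof (intro ringI abelian_groupI monoidI)
    fix f :: "'k \<times> 'k \<times> 'k \<times> 'k"
    obtain a b c d where "f = (a, b, c, d)" by (cases f)
    then show "\<exists>g\<in>carrier (qplane_alg t). g \<oplus>\<^bsub>qplane_alg t\<^esub> f = \<zero>\<^bsub>qplane_alg t\<^esub>"
      by (intro bexI[of _ "(-a, -b, -c, -d)"]) (auto simp: qplane_alg_def)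
  qed (auto simp: qplane_alg_def algebra_simps)
  then show ?thesis
    by (intro k_algebra.intro k_algebra_axioms.intro) (auto simp: qplane_alg_def algebra_simps)
qed

lemma (in ring) pow_eq_zero_of_square:
  assumes "x \<in> carrier R" "x \<otimes> x = \<zero>" "2 \<le> (m::nat)"
  shows "x [^] m = \<zero>"
proof -
  have "x [^] (2 + k) = \<zero>" for k :: nat
    using assms by (induction k) (simp_all add: numeral_2_eq_2)
  then show ?thesis using le_Suc_ex[OF assms(3)] by metis
qed

context
  fixes n :: nat and q :: "nat \<Rightarrow> nat \<Rightarrow> 'k::field" and a :: "nat \<Rightarrow> nat"
  assumes a: "\<And>i. i \<in> {1..n} \<Longrightarrow> a i \<ge> 2"
    and q_diag: "\<And>i. i \<in> {1..n} \<Longrightarrow> q i i = -1"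
begin

text \<open>Mixed relations vanish because at most one generator survives, and the relation of
  \<open>i\<close> with itself becomes \<open>X^2 - X^2 = 0\<close> by \<open>q_diag\<close>. The
  bound \<open>a i \<ge> 2\<close> puts \<open>fps_X\<close> into the carrier of
  \<open>trunc_alg (a i)\<close>.\<close>

lemma qci_coeff_hom:
  assumes i: "i \<in> {1..n}"
  obtains h where "h \<in> alg_hom (qci n q a) (trunc_alg (a i))"
    "\<And>j. j \<in> {1..n} \<Longrightarrow> h (qci_gen n q a j) = (if j = i then fps_X else 0)"
proof (rule qci_lift[of "trunc_alg (a i) :: ('k, _) module" n "\<lambda>j. if j = i then fps_X else 0" a q])
  interpret T: k_algebra "trunc_alg (a i) :: ('k, _) module" by (rule k_algebra_trunc_alg)
  show "k_algebra (trunc_alg (a i) :: ('k, _) module)" by (rule k_algebra_trunc_alg)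
  fix j l assume j: "j \<in> {1..n}" and l: "l \<in> {1..n}"
  show "(if j = i then fps_X else 0) [^]\<^bsub>(trunc_alg (a i) :: ('k, _) module)\<^esub> a j = \<zero>\<^bsub>trunc_alg (a i)\<^esub>"
    using a[OF j] unfolding trunc_alg_pow
    by (auto simp: trunc_alg_def fps_eq_iff fps_X_power_nth zero_power)
  show "(if j = i then fps_X else 0) \<otimes>\<^bsub>trunc_alg (a i)\<^esub> (if l = i then fps_X else 0) \<oplus>\<^bsub>trunc_alg (a i)\<^esub>
    q j l \<odot>\<^bsub>trunc_alg (a i)\<^esub> ((if l = i then fps_X else 0) \<otimes>\<^bsub>trunc_alg (a i)\<^esub> (if j = i then fps_X else 0))
      = \<zero>\<^bsub>trunc_alg (a i)\<^esub>"
    using q_diag[OF i] by (auto simp: trunc_alg_def fps_eq_iff)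
qed (use a[OF i] in \<open>auto simp: trunc_alg_def\<close>)

text \<open>For distinct \<open>i\<close> and \<open>j\<close>, a quantum plane quotient keeps the
  product of these two generators nonzero. Commutativity then forces its parameter \<open>t\<close>
  to be \<open>1\<close>.\<close>

lemma cring_qci_imp_q:
  assumes comm: "cring (qci n q a)" and ij: "i \<in> {1..n}" "j \<in> {1..n}"
    and inv: "q i j * q j i = 1"
  shows "q i j = -1"
proof (cases "i = j")
  case False
  \<comment> \<open>The relation for \<open>(j, i)\<close> reads
    \<open>x_j x_i = - q j i x_i x_j\<close>, which dictates \<open>t = - q j i\<close>.\<close>
  let ?B = "qplane_alg (- q j i)"
  let ?b = "\<lambda>l. if l = i then (0, 1, 0, 0) else if l = j then (0, 0, 1, 0) else (0, 0, 0, 0)"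
  interpret B: k_algebra ?B by (rule k_algebra_qplane_alg)
  have sq: "?b l [^]\<^bsub>?B\<^esub> a l = \<zero>\<^bsub>?B\<^esub>" if "l \<in> {1..n}" for l
    by (rule B.pow_eq_zero_of_square) (use a[OF that] in \<open>auto simp: qplane_alg_def\<close>)
  \<comment> \<open>For \<open>(i, j)\<close> the coefficient of \<open>x y\<close> is
    \<open>1 - q i j q j i\<close>, which is zero by \<open>inv\<close>; for equal indices both
    products are squares and vanish.\<close>
  have rel: "?b l \<otimes>\<^bsub>?B\<^esub> ?b m \<oplus>\<^bsub>?B\<^esub> q l m \<odot>\<^bsub>?B\<^esub> (?b m \<otimes>\<^bsub>?B\<^esub> ?b l) = \<zero>\<^bsub>?B\<^esub>" for l m
    using inv False by (auto simp: qplane_alg_def mult.commute)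
  obtain h where h: "h \<in> alg_hom (qci n q a) ?B"
    and hgen: "\<And>l. l \<in> {1..n} \<Longrightarrow> h (qci_gen n q a l) = ?b l"
    by (rule qci_lift[of ?B n ?b a q, OF k_algebra_qplane_alg _ sq rel]) (simp_all add: qplane_alg_def)
  interpret A: cring "qci n q a" by fact
  note gen = qci_gen_closed[OF ij(1), of q a] qci_gen_closed[OF ij(2), of q a]
  have "h (qci_gen n q a i \<otimes>\<^bsub>qci n q a\<^esub> qci_gen n q a j) = h (qci_gen n q a j \<otimes>\<^bsub>qci n q a\<^esub> qci_gen n q a i)"
    using A.m_comm[OF gen] by simp
  then have "- q j i = 1"
    using gen ij False by (simp add: alg_homD[OF h] hgen) (simp add: qplane_alg_def)
  then have "q j i = -1" by (metis minus_minus)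
  then show ?thesis using inv by (metis minus_minus mult_minus1_right)
qed (use q_diag ij in auto)

end


section \<open>Bialgebra structures force the parameters\<close>

text \<open>Write \<open>m = p^e l\<close> with \<open>l\<close> prime to \<open>p\<close>. The
  binomial coefficient of \<open>m\<close> over \<open>p^e\<close> has the same
  \<open>p\<close>-adic valuation as \<open>l\<close>, namely zero, so it survives in the field;
  this is a contradiction unless \<open>l = 1\<close>.\<close>

lemma prime_power_of_binomials_vanish:
  assumes m: "m \<ge> 2" and vanish: "\<And>r. 0 < r \<Longrightarrow> r < m \<Longrightarrow> of_nat (m choose r) = (0 :: 'k::field)"
  shows "prime CHAR('k)" and "\<exists>e\<ge>1. m = CHAR('k) ^ e"
proof -
  let ?p = "CHAR('k)"
  \<comment> \<open>The case \<open>r = 1\<close> has coefficient \<open>m\<close>. As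
    \<open>m\<close> is positive, the characteristic cannot be zero, and so it is prime.\<close>
  have "?p dvd m" using vanish[of 1] m by (simp add: of_nat_eq_0_iff_char_dvd)
  then have "?p > 0" using m by (auto intro!: Nat.gr0I)
  then show p: "prime ?p" by (rule prime_CHAR_semidom)
  obtain l where l: "m = ?p ^ multiplicity ?p m * l" "\<not> ?p dvd l"
    using multiplicity_decompose'[of m ?p] p m by (metis not_prime_unit not_numeral_le_zero)
  define e where "e = multiplicity ?p m"
  have me: "m = ?p ^ e * l" using l(1) by (simp add: e_def)
  have "l > 0" using me m by (auto intro!: Nat.gr0I)
  have "l = 1"
  proof (rule ccontr)
    assume "l \<noteq> 1"
    then have "l > 1" using \<open>l > 0\<close> by simp
    have "0 < ?p ^ e" using \<open>?p > 0\<close> by simp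
    moreover have lt: "?p ^ e < m" using \<open>l > 1\<close> \<open>0 < ?p ^ e\<close> unfolding me by simp
    ultimately have "?p dvd (m choose (?p ^ e))"
      using vanish[of "?p ^ e"] by (simp add: of_nat_eq_0_iff_char_dvd)
    moreover have "multiplicity ?p (m choose (?p ^ e)) = multiplicity ?p l"
      unfolding me by (rule const_p_fac[OF \<open>l > 0\<close> p])
    moreover have "m choose (?p ^ e) \<noteq> 0" using lt by simp
    ultimately show False
      using l(2) p by (metis multiplicity_eq_zero_iff not_dvd_imp_multiplicity_0 not_prime_unit)
  qed
  then have "m = ?p ^ e" using me by simp
  \<comment> \<open>Exponent \<open>0\<close> would give \<open>m = 1\<close>.\<close>
  moreover from this have "e \<ge> 1" using m by (cases e) auto
  ultimately show "\<exists>e\<ge>1. m = ?p ^ e" by blast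
qed

section \<open>Coefficients of elements of the tensor square\<close>

context
  fixes A :: "('k::field, 'a) module" and h1 h2 :: "'a \<Rightarrow> 'k fps" and m1 m2 :: nat
  assumes A: "k_algebra A" and h1: "h1 \<in> alg_hom A (trunc_alg m1)" and h2: "h2 \<in> alg_hom A (trunc_alg m2)"
begin

interpretation A: k_algebra A by (rule A)
interpretation T: k_algebra "tensor_alg A A" by (rule k_algebra_tensor_alg[OF A A])

text \<open>When \<open>h1\<close> and \<open>h2\<close> send \<open>x\<^sub>i\<close>, respectively \<open>x\<^sub>j\<close>, to \<open>X\<close> and the other generators to \<open>0\<close>,
  this is the coefficient of \<open>x\<^sub>i\<^sup>r \<otimes> x\<^sub>j\<^sup>s\<close>.\<close>

definition tcoeff :: "nat \<Rightarrow> nat \<Rightarrow> ('a \<times> 'a \<Rightarrow>\<^sub>0 'k) set \<Rightarrow> 'k" where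
  "tcoeff r s = tensor_lift ground_alg (\<lambda>x y. fps_nth (h1 x) r * fps_nth (h2 y) s)"

lemmas nth1 = trunc_alg_hom_nth[OF h1] and nth2 = trunc_alg_hom_nth[OF h2]

lemma tcoeff_bilin: "bilin A A ground_alg (\<lambda>x y. fps_nth (h1 x) r * fps_nth (h2 y) s)"
  by (rule bilinI) (simp_all add: nth1 nth2 algebra_simps)

lemma tcoeff_pure:
  "x \<in> carrier A \<Longrightarrow> y \<in> carrier A \<Longrightarrow>
    tcoeff r s (pure_tensor A A x y) = fps_nth (h1 x) r * fps_nth (h2 y) s"
  unfolding tcoeff_def by (rule tensor_lift_pure[OF A A k_algebra_ground_alg tcoeff_bilin])

lemma tcoeff_lin_map: "tcoeff r s \<in> lin_map (tensor_alg A A) ground_alg"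
  unfolding tcoeff_def by (rule tensor_lift_lin_map[OF A A k_algebra_ground_alg tcoeff_bilin])

lemmas tcoeff_lin = lin_mapD(2,3)[OF tcoeff_lin_map, simplified]

lemma tcoeff_zero: "tcoeff r s \<zero>\<^bsub>tensor_alg A A\<^esub> = 0"
  using lin_map_zero[OF T.k_algebra_axioms k_algebra_ground_alg tcoeff_lin_map] by simp

lemma tcoeff_one:
  "r < m1 \<Longrightarrow> s < m2 \<Longrightarrow> tcoeff r s \<one>\<^bsub>tensor_alg A A\<^esub> = (if r = 0 \<and> s = 0 then 1 else 0)"
  by (simp add: pure_one[OF A A] tcoeff_pure nth1 nth2)

text \<open>Two-variable Cauchy product. Both sides are additive in \<open>X\<close> and in
  \<open>Y\<close>, and on pure tensors the double sum is a product of two one-variable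
  convolutions.\<close>

lemma tcoeff_mult:
  assumes X: "X \<in> carrier (tensor_alg A A)" and Y: "Y \<in> carrier (tensor_alg A A)"
    and r: "r < m1" and s: "s < m2"
  shows "tcoeff r s (X \<otimes>\<^bsub>tensor_alg A A\<^esub> Y) = (\<Sum>k\<le>r. \<Sum>l\<le>s. tcoeff k l X * tcoeff (r - k) (s - l) Y)"
  using X
proof (induction rule: tensor_induct[OF A A, consumes 1, case_names pure add])
  case (pure x y)
  show ?case
    using Y
  proof (induction rule: tensor_induct[OF A A, consumes 1, case_names pure add])
    case (pure x' y')
    have "tcoeff r s (pure_tensor A A x y \<otimes>\<^bsub>tensor_alg A A\<^esub> pure_tensor A A x' y')
        = (\<Sum>k\<le>r. fps_nth (h1 x) k * fps_nth (h1 x') (r - k)) *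
          (\<Sum>l\<le>s. fps_nth (h2 y) l * fps_nth (h2 y') (s - l))"
      using pure \<open>x \<in> carrier A\<close> \<open>y \<in> carrier A\<close> r s
      by (simp add: pure_mult[OF A A] tcoeff_pure nth1 nth2)
    then show ?case
      using pure \<open>x \<in> carrier A\<close> \<open>y \<in> carrier A\<close>
      by (simp add: tcoeff_pure sum_product ac_simps)
  qed (use pure in \<open>simp add: T.r_distr tcoeff_lin pure_closed[OF A A] distrib_left sum.distrib\<close>)
qed (use Y in \<open>simp add: T.l_distr tcoeff_lin distrib_right sum.distrib\<close>)

text \<open>As far as \<open>tcoeff\<close> sees, \<open>d\<close> is \<open>X + Y\<close> plus
  terms of total degree at least 2. In total degree at most \<open>j\<close>, its
  \<open>j\<close>-th power therefore agrees with \<open>(X + Y)^j\<close>; in higher degree the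
  unknown terms of \<open>d\<close> interfere.\<close>

lemma tcoeff_pow:
  assumes d: "d \<in> carrier (tensor_alg A A)"
    and d0: "tcoeff 0 0 d = 0" and d1: "tcoeff 1 0 d = 1" "tcoeff 0 1 d = 1"
  shows "r < m1 \<Longrightarrow> s < m2 \<Longrightarrow> r + s \<le> j \<Longrightarrow>
    tcoeff r s (d [^]\<^bsub>tensor_alg A A\<^esub> j) = (if r + s = j then of_nat (j choose r) else 0)"
proof (induction j arbitrary: r s)
  case 0
  then show ?case by (simp add: tcoeff_one)
next
  case (Suc j)
  let ?t = "\<lambda>k l. tcoeff k l (d [^]\<^bsub>tensor_alg A A\<^esub> j)"
  have "?t k l * tcoeff (r - k) (s - l) d =
      (if l = s then if Suc k = r then ?t k l else 0 else 0) + (if k = r then if Suc l = s then ?t k l else 0 else 0)"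
    if kl: "k \<le> r" "l \<le> s" for k l
  proof -
    \<comment> \<open>These are the degrees left over for the last factor \<open>d\<close>: degree
      zero, where \<open>d\<close> vanishes; the two of total degree one, where \<open>d\<close> has
      coefficient \<open>1\<close>; and total degree at least two, where the \<open>j\<close>-th
      power vanishes by induction.\<close>
    consider "k = r \<and> l = s" | "Suc k = r \<and> l = s" | "k = r \<and> Suc l = s" | "k + l < j"
      using kl Suc.prems by linarith
    then show ?thesis
      by cases (use Suc.prems kl d0 d1 in \<open>auto simp: Suc.IH\<close>)
  qed
  then have "tcoeff r s (d [^]\<^bsub>tensor_alg A A\<^esub> Suc j) = (\<Sum>k\<le>r. \<Sum>l\<le>s.
      (if l = s then if Suc k = r then ?t k l else 0 else 0) + (if k = r then if Suc l = s then ?t k l else 0 else 0))"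
    using d Suc.prems by (simp add: tcoeff_mult)
  also have "\<dots> = (if r > 0 then ?t (r - 1) s else 0) + (if s > 0 then ?t r (s - 1) else 0)"
  proof -
    have "(\<Sum>k\<le>r. \<Sum>l\<le>s. if l = s then if Suc k = r then ?t k l else 0 else 0) = (if r > 0 then ?t (r - 1) s else 0)"
      by (cases r) simp_all
    moreover have "(\<Sum>k\<le>r. \<Sum>l\<le>s. if k = r then if Suc l = s then ?t k l else 0 else 0) = (if s > 0 then ?t r (s - 1) else 0)"
      by (subst sum.swap, cases s) simp_all
    ultimately show ?thesis by (simp add: sum.distrib)
  qed
  \<comment> \<open>Pascal's rule; the boundary cases \<open>r = 0\<close> and \<open>s = 0\<close>
    have only one summand.\<close>
  also have "\<dots> = (if r + s = Suc j then of_nat (Suc j choose r) else 0)"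
    using Suc.prems by (cases r; cases s) (auto simp: Suc.IH)
  finally show ?case .
qed

text \<open>When \<open>\<epsilon>\<close> is the constant coefficient, applying it to one tensor
  factor selects degree zero in that factor. The counit axioms thus determine the coefficients of a
  coproduct with \<open>r = 0\<close> or \<open>s = 0\<close>.\<close>

lemma tcoeff_counit:
  assumes X: "X \<in> carrier (tensor_alg A A)"
    and eps: "\<epsilon> \<in> alg_hom A ground_alg"
  shows "(\<And>x. x \<in> carrier A \<Longrightarrow> \<epsilon> x = fps_nth (h2 x) 0) \<Longrightarrow>
      fps_nth (h1 (tensor_lift A (\<lambda>y z. \<epsilon> z \<odot>\<^bsub>A\<^esub> y) X)) r = tcoeff r 0 X"
    and "(\<And>x. x \<in> carrier A \<Longrightarrow> \<epsilon> x = fps_nth (h1 x) 0) \<Longrightarrow>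
      fps_nth (h2 (tensor_lift A (\<lambda>y z. \<epsilon> y \<odot>\<^bsub>A\<^esub> z) X)) s = tcoeff 0 s X"
proof -
  note e = alg_homD(2,3,5)[OF eps, simplified]
  have b: "bilin A A A (\<lambda>y z. \<epsilon> z \<odot>\<^bsub>A\<^esub> y)" "bilin A A A (\<lambda>y z. \<epsilon> y \<odot>\<^bsub>A\<^esub> z)"
    by (rule bilinI; simp add: e A.smult_l_distr A.smult_r_distr A.smult_smult mult.commute)+
  note l = tensor_lift_lin_map[OF A A A b(1)] tensor_lift_lin_map[OF A A A b(2)]
  show "fps_nth (h1 (tensor_lift A (\<lambda>y z. \<epsilon> z \<odot>\<^bsub>A\<^esub> y) X)) r = tcoeff r 0 X"
    if "\<And>x. x \<in> carrier A \<Longrightarrow> \<epsilon> x = fps_nth (h2 x) 0"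
    using X
    by (induction rule: tensor_induct[OF A A, consumes 1, case_names pure add])
      (simp_all add: tensor_lift_pure[OF A A A b(1)] tcoeff_pure tcoeff_lin lin_mapD[OF l(1)] nth1 that mult.commute)
  show "fps_nth (h2 (tensor_lift A (\<lambda>y z. \<epsilon> y \<odot>\<^bsub>A\<^esub> z) X)) s = tcoeff 0 s X"
    if "\<And>x. x \<in> carrier A \<Longrightarrow> \<epsilon> x = fps_nth (h1 x) 0"
    using X
    by (induction rule: tensor_induct[OF A A, consumes 1, case_names pure add])
      (simp_all add: tensor_lift_pure[OF A A A b(2)] tcoeff_pure tcoeff_lin lin_mapD[OF l(2)] nth2 that mult.commute)
qed

end

section \<open>Constraints imposed by a given bialgebra structure\<close>

context
  fixes n :: nat and q :: "nat \<Rightarrow> nat \<Rightarrow> 'k::field" and a :: "nat \<Rightarrow> nat"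
    and \<Delta> :: "(nat list \<Rightarrow>\<^sub>0 'k) set \<Rightarrow> ((nat list \<Rightarrow>\<^sub>0 'k) set \<times> (nat list \<Rightarrow>\<^sub>0 'k) set \<Rightarrow>\<^sub>0 'k) set"
    and \<epsilon> :: "(nat list \<Rightarrow>\<^sub>0 'k) set \<Rightarrow> 'k"
  assumes a: "\<And>i. i \<in> {1..n} \<Longrightarrow> a i \<ge> 2"
    and q_diag: "\<And>i. i \<in> {1..n} \<Longrightarrow> q i i = -1"
    and bialg: "is_bialgebra (qci n q a) \<Delta> \<epsilon>"
begin

interpretation A: k_algebra "qci n q a" by (rule k_algebra_qci)
interpretation T: k_algebra "tensor_alg (qci n q a) (qci n q a)"
  by (rule k_algebra_tensor_alg[OF A.k_algebra_axioms A.k_algebra_axioms])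

lemma bialgD:
  "\<Delta> \<in> alg_hom (qci n q a) (tensor_alg (qci n q a) (qci n q a))"
  "\<epsilon> \<in> alg_hom (qci n q a) ground_alg"
  "x \<in> carrier (qci n q a) \<Longrightarrow> tensor_lift (qci n q a) (\<lambda>y z. \<epsilon> y \<odot>\<^bsub>qci n q a\<^esub> z) (\<Delta> x) = x"
  "x \<in> carrier (qci n q a) \<Longrightarrow> tensor_lift (qci n q a) (\<lambda>y z. \<epsilon> z \<odot>\<^bsub>qci n q a\<^esub> y) (\<Delta> x) = x"
  using bialg by (auto simp: is_bialgebra_def)

text \<open>The value is a nilpotent element of a field.\<close>

lemma counit_gen: "i \<in> {1..n} \<Longrightarrow> \<epsilon> (qci_gen n q a i) = 0"
  using alg_hom_pow[OF A.k_algebra_axioms k_algebra_ground_alg bialgD(2) qci_gen_closed, of i "a i"]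
    lin_map_zero[OF A.k_algebra_axioms k_algebra_ground_alg alg_hom_lin_map[OF bialgD(2)]]
  by (simp add: qci_gen_pow ground_alg_pow)

text \<open>Both sides are algebra homomorphisms to the ground field that kill all
  generators.\<close>

lemma counit_eq_coeff:
  assumes h: "h \<in> alg_hom (qci n q a) (trunc_alg m)" and m: "m > 0"
    and gen: "\<And>j. j \<in> {1..n} \<Longrightarrow> fps_nth (h (qci_gen n q a j)) 0 = 0"
    and x: "x \<in> carrier (qci n q a)"
  shows "\<epsilon> x = fps_nth (h x) 0"
proof (rule alg_hom_qci_eqI[OF bialgD(2) _ _ x])
  show "(\<lambda>x. fps_nth (h x) 0) \<in> alg_hom (qci n q a) ground_alg"
    by (rule alg_homI) (simp_all add: trunc_alg_hom_nth[OF h] m)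
qed (simp add: gen counit_gen)

text \<open>The counit axioms turn these coefficients of the coproduct into coefficients of
  \<open>h1\<close> and \<open>h2\<close> at the generator itself. Terms of positive degree in both
  factors remain unknown.\<close>

lemma bialgebra_tcoeff:
  assumes ij: "i \<in> {1..n}" "j \<in> {1..n}"
    and h1: "h1 \<in> alg_hom (qci n q a) (trunc_alg (a i))"
    and g1: "\<And>l. l \<in> {1..n} \<Longrightarrow> h1 (qci_gen n q a l) = (if l = i then fps_X else 0)"
    and h2: "h2 \<in> alg_hom (qci n q a) (trunc_alg (a j))"
    and g2: "\<And>l. l \<in> {1..n} \<Longrightarrow> h2 (qci_gen n q a l) = (if l = j then fps_X else 0)"
    and l: "l \<in> {1..n}"
  shows "tcoeff h1 h2 r 0 (\<Delta> (qci_gen n q a l)) = (if l = i \<and> r = 1 then 1 else 0)"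
    and "tcoeff h1 h2 0 s (\<Delta> (qci_gen n q a l)) = (if l = j \<and> s = 1 then 1 else 0)"
proof -
  note gen = qci_gen_closed[OF l, of q a]
  have e: "\<epsilon> x = fps_nth (h1 x) 0" "\<epsilon> x = fps_nth (h2 x) 0" if "x \<in> carrier (qci n q a)" for x
    using counit_eq_coeff[OF h1 _ _ that] counit_eq_coeff[OF h2 _ _ that] g1 g2 a[OF ij(1)] a[OF ij(2)]
    by auto
  note c = tcoeff_counit[OF A.k_algebra_axioms h1 h2 alg_homD(1)[OF bialgD(1) gen] bialgD(2)]
  show "tcoeff h1 h2 r 0 (\<Delta> (qci_gen n q a l)) = (if l = i \<and> r = 1 then 1 else 0)"
    by (subst c(1)[symmetric]) (simp_all add: e(2) bialgD(4)[OF gen] g1[OF l])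
  show "tcoeff h1 h2 0 s (\<Delta> (qci_gen n q a l)) = (if l = j \<and> s = 1 then 1 else 0)"
    by (subst c(2)[symmetric]) (simp_all add: e(1) bialgD(3)[OF gen] g2[OF l])
qed

lemma bialgebra_imp_q:
  assumes ij: "i \<in> {1..n}" "j \<in> {1..n}"
  shows "q i j = -1"
proof (cases "i = j")
  case False
  obtain h1 where h1: "h1 \<in> alg_hom (qci n q a) (trunc_alg (a i))"
    "\<And>l. l \<in> {1..n} \<Longrightarrow> h1 (qci_gen n q a l) = (if l = i then fps_X else 0)"
    using qci_coeff_hom[where n = n and a = a and q = q, OF a q_diag ij(1)] by blast
  obtain h2 where h2: "h2 \<in> alg_hom (qci n q a) (trunc_alg (a j))"
    "\<And>l. l \<in> {1..n} \<Longrightarrow> h2 (qci_gen n q a l) = (if l = j then fps_X else 0)"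
    using qci_coeff_hom[where n = n and a = a and q = q, OF a q_diag ij(2)] by blast
  let ?F = "tcoeff h1 h2" and ?di = "\<Delta> (qci_gen n q a i)" and ?dj = "\<Delta> (qci_gen n q a j)"
  have c: "?F r 0 (\<Delta> (qci_gen n q a l)) = (if l = i \<and> r = 1 then 1 else 0)"
    "?F 0 r (\<Delta> (qci_gen n q a l)) = (if l = j \<and> r = 1 then 1 else 0)"
    if "l \<in> {1..n}" for r l
    by (rule bialgebra_tcoeff[OF ij h1(1) _ h2(1) _ that]; simp add: h1(2) h2(2))+
  note gen = qci_gen_closed[OF ij(1), of q a] qci_gen_closed[OF ij(2), of q a]
  note D = alg_homD[OF bialgD(1)]
  have d: "?di \<in> carrier (tensor_alg (qci n q a) (qci n q a))" "?dj \<in> carrier (tensor_alg (qci n q a) (qci n q a))"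
    using gen by (simp_all add: D)
  have lt: "1 < a i" "1 < a j" using a[OF ij(1)] a[OF ij(2)] by auto
  \<comment> \<open>Of the four terms in the convolution, the unknown coefficients at
    \<open>(1, 1)\<close> are multiplied by a coefficient at \<open>(0, 0)\<close>, which is zero.
    Of the other two exactly one is \<open>1\<close>, because \<open>i\<close> and \<open>j\<close>
    differ.\<close>
  have "?F 1 1 (?di \<otimes>\<^bsub>tensor_alg (qci n q a) (qci n q a)\<^esub> ?dj) = 1"
    "?F 1 1 (?dj \<otimes>\<^bsub>tensor_alg (qci n q a) (qci n q a)\<^esub> ?di) = 1"
    using d lt False ij
    by (simp_all add: tcoeff_mult[OF A.k_algebra_axioms h1(1) h2(1)] c atMost_Suc)
  moreover have "?di \<otimes>\<^bsub>tensor_alg (qci n q a) (qci n q a)\<^esub> ?dj \<oplus>\<^bsub>tensor_alg (qci n q a) (qci n q a)\<^esub>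
      q i j \<odot>\<^bsub>tensor_alg (qci n q a) (qci n q a)\<^esub> (?dj \<otimes>\<^bsub>tensor_alg (qci n q a) (qci n q a)\<^esub> ?di)
      = \<zero>\<^bsub>tensor_alg (qci n q a) (qci n q a)\<^esub>"
    using arg_cong[OF qci_gen_commute[OF ij, of q a], of \<Delta>] gen
      lin_map_zero[OF A.k_algebra_axioms T.k_algebra_axioms alg_hom_lin_map[OF bialgD(1)]]
    by (simp add: D)
  then have "?F 1 1 (?di \<otimes>\<^bsub>tensor_alg (qci n q a) (qci n q a)\<^esub> ?dj \<oplus>\<^bsub>tensor_alg (qci n q a) (qci n q a)\<^esub>
      q i j \<odot>\<^bsub>tensor_alg (qci n q a) (qci n q a)\<^esub> (?dj \<otimes>\<^bsub>tensor_alg (qci n q a) (qci n q a)\<^esub> ?di)) = 0"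
    by (simp add: tcoeff_zero[OF A.k_algebra_axioms h1(1) h2(1)])
  ultimately have "1 + q i j = 0"
    using d by (simp add: tcoeff_lin[OF A.k_algebra_axioms h1(1) h2(1)])
  then show ?thesis by (simp add: add_eq_0_iff)
qed (use q_diag ij in auto)

text \<open>The same coefficient map \<open>h\<close> is used in both tensor factors, and
  \<open>(\<Delta> x_i)^(a i) = 0\<close> is read off in total degree \<open>a i\<close>.\<close>

lemma bialgebra_imp_prime_power:
  assumes i: "i \<in> {1..n}"
  shows "prime CHAR('k)" "\<exists>e\<ge>1. a i = CHAR('k) ^ e"
proof -
  obtain h where h: "h \<in> alg_hom (qci n q a) (trunc_alg (a i))"
    "\<And>l. l \<in> {1..n} \<Longrightarrow> h (qci_gen n q a l) = (if l = i then fps_X else 0)"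
    using qci_coeff_hom[where n = n and a = a and q = q, OF a q_diag i] by blast
  let ?d = "\<Delta> (qci_gen n q a i)"
  have c: "tcoeff h h r 0 ?d = (if r = 1 then 1 else 0)" "tcoeff h h 0 r ?d = (if r = 1 then 1 else 0)" for r
    by (subst bialgebra_tcoeff[OF i i h(1) _ h(1) _ i]; simp add: h(2))+
  note gen = qci_gen_closed[OF i, of q a]
  have d: "?d \<in> carrier (tensor_alg (qci n q a) (qci n q a))" using gen by (rule alg_homD(1)[OF bialgD(1)])
  have "?d [^]\<^bsub>tensor_alg (qci n q a) (qci n q a)\<^esub> a i = \<zero>\<^bsub>tensor_alg (qci n q a) (qci n q a)\<^esub>"
    using alg_hom_pow[OF A.k_algebra_axioms T.k_algebra_axioms bialgD(1) gen, of "a i"]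
      lin_map_zero[OF A.k_algebra_axioms T.k_algebra_axioms alg_hom_lin_map[OF bialgD(1)]]
    by (simp add: qci_gen_pow[OF i])
  \<comment> \<open>The second index is \<open>a i - r\<close>; both indices lie below the
    truncation bound precisely because \<open>0 < r < a i\<close>.\<close>
  then have "of_nat (a i choose r) = (0 :: 'k)" if "0 < r" "r < a i" for r
    using tcoeff_pow[OF A.k_algebra_axioms h(1) h(1) d, of r "a i - r" "a i"] that
    by (simp add: c tcoeff_zero[OF A.k_algebra_axioms h(1) h(1)])
  then show "prime CHAR('k)" "\<exists>e\<ge>1. a i = CHAR('k) ^ e"
    using prime_power_of_binomials_vanish[where 'k = 'k, OF a[OF i]] by auto
qed

end


section \<open>The Hopf algebra structure with primitive generators\<close>

lemma tensor_map_alg_hom: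
  assumes A: "k_algebra A" and B: "k_algebra B" and C: "k_algebra C" and D: "k_algebra D"
    and f: "f \<in> alg_hom A C" and g: "g \<in> alg_hom B D"
  shows "tensor_map C D f g \<in> alg_hom (tensor_alg A B) (tensor_alg C D)"
    and "x \<in> carrier A \<Longrightarrow> y \<in> carrier B \<Longrightarrow>
      tensor_map C D f g (pure_tensor A B x y) = pure_tensor C D (f x) (g y)"
proof -
  note T = k_algebra_tensor_alg[OF C D]
  have b: "bilin A B (tensor_alg C D) (\<lambda>x y. pure_tensor C D (f x) (g y))"
    by (rule bilinI) (simp_all add: alg_homD[OF f] alg_homD[OF g] pure_simps[OF C D] pure_closed[OF C D])
  show "tensor_map C D f g \<in> alg_hom (tensor_alg A B) (tensor_alg C D)"
    unfolding tensor_map_def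
    by (rule tensor_lift_alg_hom[OF A B T b])
      (simp_all add: alg_homD[OF f] alg_homD[OF g] pure_mult[OF C D] pure_one[OF C D])
  show "tensor_map C D f g (pure_tensor A B x y) = pure_tensor C D (f x) (g y)"
    if "x \<in> carrier A" "y \<in> carrier B"
    unfolding tensor_map_def by (rule tensor_lift_pure[OF A B T b that])
qed

text \<open>The map is a lift in two stages: first over \<open>(x, y)\<close> with \<open>z\<close>
  fixed, then over the resulting tensor and \<open>z\<close>. Its values on pure tensors determine
  the rest.\<close>

lemma tensor_assoc_alg_hom:
  assumes A: "k_algebra A" and B: "k_algebra B" and C: "k_algebra C"
  shows "tensor_assoc A B C \<in> alg_hom (tensor_alg (tensor_alg A B) C) (tensor_alg A (tensor_alg B C))"
    and "x \<in> carrier A \<Longrightarrow> y \<in> carrier B \<Longrightarrow> z \<in> carrier C \<Longrightarrow>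
      tensor_assoc A B C (pure_tensor (tensor_alg A B) C (pure_tensor A B x y) z)
        = pure_tensor A (tensor_alg B C) x (pure_tensor B C y z)"
proof -
  let ?AB = "tensor_alg A B" and ?BC = "tensor_alg B C"
  let ?T = "tensor_alg A ?BC"
  note AB = k_algebra_tensor_alg[OF A B] and BC = k_algebra_tensor_alg[OF B C]
  note T = k_algebra_tensor_alg[OF A BC]
  interpret A: k_algebra A by (rule A)
  interpret B: k_algebra B by (rule B)
  interpret C: k_algebra C by (rule C)
  interpret AB: k_algebra ?AB by (rule AB)
  interpret T: k_algebra ?T by (rule T)
  note [simp] = pure_closed[OF A B] pure_closed[OF B C] pure_closed[OF A BC]
    pure_simps[OF B C] pure_simps[OF A BC]
  define \<beta> where "\<beta> z x y = pure_tensor A ?BC x (pure_tensor B C y z)" for z x y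
  define \<gamma> where "\<gamma> X z = tensor_lift ?T (\<beta> z) X" for X z
  have b: "bilin A B ?T (\<beta> z)" if "z \<in> carrier C" for z
    unfolding \<beta>_def by (rule bilinI) (simp_all add: that)
  have \<gamma>_pure: "\<gamma> (pure_tensor A B x y) z = \<beta> z x y" if "x \<in> carrier A" "y \<in> carrier B" "z \<in> carrier C" for x y z
    unfolding \<gamma>_def using that by (intro tensor_lift_pure[OF A B T b])
  have lin: "(\<lambda>X. \<gamma> X z) \<in> lin_map ?AB ?T" if "z \<in> carrier C" for z
    unfolding \<gamma>_def using tensor_lift_lin_map[OF A B T b[OF that]] by (simp add: eta_contract_eq)
  note lin = lin_mapD[OF lin]
  have \<beta>_closed: "\<beta> z x y \<in> carrier ?T" if "x \<in> carrier A" "y \<in> carrier B" "z \<in> carrier C" for x y z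
    using bilinD(1)[OF b] that by blast
  \<comment> \<open>Linearity in the tensor \<open>X\<close> comes from the inner lift; linearity in
    \<open>z\<close> is checked on pure tensors \<open>X\<close> and extended by addition.\<close>
  have c: "bilin ?AB C ?T \<gamma>"
  proof (rule bilinI)
    fix X z z' assume X: "X \<in> carrier ?AB" and z: "z \<in> carrier C" "z' \<in> carrier C"
    show "\<gamma> X (z \<oplus>\<^bsub>C\<^esub> z') = \<gamma> X z \<oplus>\<^bsub>?T\<^esub> \<gamma> X z'"
      using X
    proof (induction rule: tensor_induct[OF A B, consumes 1, case_names pure add])
      case (pure x y)
      then show ?case using z by (simp add: \<gamma>_pure \<beta>_def)
    next
      case (add X Y)
      then show ?case using z by (simp add: lin T.a_ac)
    qed
  next
    fix X z c assume X: "X \<in> carrier ?AB" and z: "z \<in> carrier C"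
    show "\<gamma> X (c \<odot>\<^bsub>C\<^esub> z) = c \<odot>\<^bsub>?T\<^esub> \<gamma> X z"
      using X
    proof (induction rule: tensor_induct[OF A B, consumes 1, case_names pure add])
      case (pure x y)
      then show ?case using z by (simp add: \<gamma>_pure \<beta>_def)
    next
      case (add X Y)
      then show ?case using z by (simp add: lin T.smult_r_distr)
    qed
  qed (simp_all add: lin)
  have assoc: "tensor_assoc A B C = tensor_lift ?T \<gamma>"
    unfolding tensor_assoc_def Let_def \<gamma>_def[abs_def] \<beta>_def[abs_def] ..
  have mult: "\<gamma> (X \<otimes>\<^bsub>?AB\<^esub> X') (z \<otimes>\<^bsub>C\<^esub> z') = \<gamma> X z \<otimes>\<^bsub>?T\<^esub> \<gamma> X' z'"
    if X: "X \<in> carrier ?AB" and X': "X' \<in> carrier ?AB" and z: "z \<in> carrier C" "z' \<in> carrier C" for X X' z z'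
    using X
  proof (induction rule: tensor_induct[OF A B, consumes 1, case_names pure add])
    case xy: (pure x y)
    show ?case
      using X'
    proof (induction rule: tensor_induct[OF A B, consumes 1, case_names pure add])
      case xy': (pure x' y')
      show ?case
        using xy xy' z by (simp add: pure_mult[OF A B] \<gamma>_pure \<beta>_def pure_mult[OF A BC] pure_mult[OF B C])
    next
      case (add X Y)
      then show ?case using xy z by (simp add: lin AB.r_distr T.r_distr)
    qed
  next
    case (add X Y)
    then show ?case using X' z by (simp add: lin AB.l_distr T.l_distr)
  qed
  show "tensor_assoc A B C \<in> alg_hom (tensor_alg ?AB C) ?T"
    unfolding assoc
    by (rule tensor_lift_alg_hom[OF AB C T c])
      (simp_all add: mult pure_one[OF A B] pure_one[OF A BC] pure_one[OF B C] \<gamma>_pure \<beta>_def)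
  show "tensor_assoc A B C (pure_tensor ?AB C (pure_tensor A B x y) z) = pure_tensor A ?BC x (pure_tensor B C y z)"
    if "x \<in> carrier A" "y \<in> carrier B" "z \<in> carrier C"
    unfolding assoc using that by (subst tensor_lift_pure[OF AB C T c]) (simp_all add: \<gamma>_pure \<beta>_def)
qed

text \<open>The usual induction through Pascal's rule, for two commuting elements of a possibly
  noncommutative algebra. Coefficients are scalars in the field, so divisibility by the
  characteristic kills a term at once.\<close>

lemma (in k_algebra) commutative_binomial:
  assumes x: "x \<in> carrier A" and y: "y \<in> carrier A" and comm: "x \<otimes> y = y \<otimes> x"
  shows "(x \<oplus> y) [^] (m::nat) = (\<Oplus>k\<in>{..m}. of_nat (m choose k) \<odot> (x [^] k \<otimes> y [^] (m - k)))"
proof (induction m)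
  case 0
  then show ?case by simp
next
  case (Suc m)
  note pow_y = group_commutes_pow[OF comm[symmetric] y x]
  let ?t = "\<lambda>k. x [^] k \<otimes> y [^] (Suc m - k)"
  let ?s = "\<lambda>k. of_nat (m choose k) \<odot> (x [^] k \<otimes> y [^] (m - k))"
  have s: "?s \<in> {..m} \<rightarrow> carrier A" and t: "\<And>k. ?t k \<in> carrier A" using x y by auto
  have "(x \<oplus> y) [^] Suc m = finsum A ?s {..m} \<otimes> x \<oplus> finsum A ?s {..m} \<otimes> y"
    using x y s by (simp add: Suc.IH r_distr finsum_closed del: finsum_Suc)
  also have "finsum A ?s {..m} \<otimes> x = (\<Oplus>k\<in>{..m}. of_nat (m choose k) \<odot> ?t (Suc k))"
    unfolding finsum_ldistr[OF _ x s, simplified]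
    using x y by (intro finsum_cong') (auto simp: smult_mult_l m_assoc pow_y)
  also have "finsum A ?s {..m} \<otimes> y = (\<Oplus>k\<in>{..m}. of_nat (m choose k) \<odot> ?t k)"
    unfolding finsum_ldistr[OF _ y s, simplified]
    using x y by (intro finsum_cong') (auto simp: smult_mult_l m_assoc Suc_diff_le)
  \<comment> \<open>Both sums are put over \<open>{..Suc m}\<close>: the first is shifted and gets a
    zero term at \<open>k = 0\<close>, the second gets one at \<open>k = Suc m\<close>, where the
    binomial coefficient vanishes.\<close>
  also have "(\<Oplus>k\<in>{..m}. of_nat (m choose k) \<odot> ?t (Suc k)) \<oplus> (\<Oplus>k\<in>{..m}. of_nat (m choose k) \<odot> ?t k)
      = (\<Oplus>k\<in>{..Suc m}. (case k of 0 \<Rightarrow> 0 | Suc l \<Rightarrow> of_nat (m choose l)) \<odot> ?t k) \<oplus>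
        (\<Oplus>k\<in>{..Suc m}. of_nat (m choose k) \<odot> ?t k)"
  proof -
    have "(\<Oplus>k\<in>{..Suc m}. (case k of 0 \<Rightarrow> 0 | Suc l \<Rightarrow> of_nat (m choose l)) \<odot> ?t k)
        = (\<Oplus>k\<in>{..m}. of_nat (m choose k) \<odot> ?t (Suc k))"
      using x y by (subst finsum_Suc2) auto
    moreover have "(\<Oplus>k\<in>{..Suc m}. of_nat (m choose k) \<odot> ?t k) = (\<Oplus>k\<in>{..m}. of_nat (m choose k) \<odot> ?t k)"
      using x y by (subst finsum_Suc) (auto simp: binomial_eq_0 intro!: finsum_closed)
    ultimately show ?thesis by simp
  qed
  also have "\<dots> = (\<Oplus>k\<in>{..Suc m}. of_nat (Suc m choose k) \<odot> ?t k)"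
  proof -
    have pascal: "(case k of 0 \<Rightarrow> 0 | Suc l \<Rightarrow> of_nat (m choose l)) \<odot> ?t k \<oplus> of_nat (m choose k) \<odot> ?t k
        = of_nat (Suc m choose k) \<odot> ?t k" for k
      using t[of k] by (cases k) (simp_all flip: smult_l_distr)
    show ?thesis
      using t by (subst finsum_addf[symmetric]) (simp_all only: pascal smult_closed Pi_I)
  qed
  finally show ?case .
qed

text \<open>Induction on \<open>e\<close>, applying the binomial formula with exponent the
  characteristic to the powers reached so far; these still commute.\<close>

lemma (in k_algebra) commutative_freshmans_dream:
  assumes p: "prime CHAR('k)" and x: "x \<in> carrier A" and y: "y \<in> carrier A" and comm: "x \<otimes> y = y \<otimes> x"
  shows "(x \<oplus> y) [^] (CHAR('k) ^ e) = x [^] (CHAR('k) ^ e) \<oplus> y [^] (CHAR('k) ^ e)"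
proof (induction e)
  case 0
  then show ?case using x y by simp
next
  case (Suc e)
  let ?p = "CHAR('k)" and ?u = "x [^] (CHAR('k) ^ e)" and ?v = "y [^] (CHAR('k) ^ e)"
  have uv: "?u \<in> carrier A" "?v \<in> carrier A" using x y by auto
  have comm': "?u \<otimes> ?v = ?v \<otimes> ?u"
    using group_commutes_pow[OF group_commutes_pow[OF comm x y, symmetric] y, symmetric] x by simp
  have p0: "?p > 0" using p prime_gt_0_nat by blast
  have "(?u \<oplus> ?v) [^] ?p = (\<Oplus>k\<in>{..?p}. of_nat (?p choose k) \<odot> (?u [^] k \<otimes> ?v [^] (?p - k)))"
    by (rule commutative_binomial[OF uv comm'])
  \<comment> \<open>A prime divides its interior binomial coefficients, so only the two end terms
    survive.\<close>
  also have "\<dots> = (\<Oplus>k\<in>{0, ?p}. of_nat (?p choose k) \<odot> (?u [^] k \<otimes> ?v [^] (?p - k)))"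
  proof (rule add.finprod_mono_neutral_cong_right)
    fix k assume "k \<in> {..?p} - {0, ?p}"
    then have "?p dvd (?p choose k)" using p by (intro dvd_choose_prime) auto
    then have "of_nat (?p choose k) = (0 :: 'k)" by (simp add: of_nat_eq_0_iff_char_dvd)
    then show "of_nat (?p choose k) \<odot> (?u [^] k \<otimes> ?v [^] (?p - k)) = \<zero>" using uv by simp
  qed (use uv in auto)
  also have "\<dots> = ?v [^] ?p \<oplus> ?u [^] ?p"
    using uv p0 by (subst finsum_insert) auto
  finally have "(?u \<oplus> ?v) [^] ?p = ?u [^] ?p \<oplus> ?v [^] ?p" using uv by (simp add: a_comm)
  moreover have "(x \<oplus> y) [^] (?p ^ Suc e) = ((x \<oplus> y) [^] (?p ^ e)) [^] ?p"
    using x y by (simp add: nat_pow_pow mult.commute)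
  ultimately show ?case
    using x y by (simp add: Suc.IH nat_pow_pow mult.commute)
qed

text \<open>Commutativity enters twice: \<open>S\<close> can be an algebra homomorphism, and the
  maps \<open>y \<otimes> z \<mapsto> S y z\<close> and \<open>y \<otimes> z \<mapsto> y S z\<close>
  are multiplicative. Hence the antipode axioms also need checking on generators only.\<close>

lemma qci_primitive_hopf:
  fixes n :: nat and q :: "nat \<Rightarrow> nat \<Rightarrow> 'k::field" and a :: "nat \<Rightarrow> nat"
  assumes comm: "cring (qci n q a)" and p: "prime CHAR('k)"
    and a: "\<And>i. i \<in> {1..n} \<Longrightarrow> \<exists>e. a i = CHAR('k) ^ e"
    and q: "\<And>i j. i \<in> {1..n} \<Longrightarrow> j \<in> {1..n} \<Longrightarrow> q i j = -1"
  shows "admits_hopf_algebra (qci n q a)"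
proof -
  let ?A = "qci n q a" and ?g = "qci_gen n q a"
  let ?T = "tensor_alg ?A ?A"
  interpret A: k_algebra ?A by (rule k_algebra_qci)
  interpret A: cring ?A by (rule comm)
  note A = A.k_algebra_axioms
  interpret T: k_algebra ?T by (rule k_algebra_tensor_alg[OF A A])
  interpret T: cring ?T by (rule cring_tensor_alg[OF A A comm comm])
  note T = T.k_algebra_axioms
  note [simp] = qci_gen_closed[of _ n q a] pure_closed[OF A A] pure_simps[OF A A]
  note pm = pure_mult[OF A A] and po = pure_one[OF A A]
  have p0: "CHAR('k) > 0" using p prime_gt_0_nat by blast
  \<comment> \<open>In a commutative target the commutation relations become
    \<open>b i b j - b j b i = 0\<close>, so only the power relations are left as a
    condition.\<close>
  have lift: "\<exists>f. f \<in> alg_hom ?A B \<and> (\<forall>i\<in>{1..n}. f (?g i) = b i)"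
    if B: "k_algebra B" "cring B" and b: "\<And>i. i \<in> {1..n} \<Longrightarrow> b i \<in> carrier B"
      and pow: "\<And>i. i \<in> {1..n} \<Longrightarrow> b i [^]\<^bsub>B\<^esub> a i = \<zero>\<^bsub>B\<^esub>"
    for B :: "('k, 'b) module" and b
  proof -
    interpret B: k_algebra B by (rule B)
    interpret B: cring B by (rule B)
    have rel: "b i \<otimes>\<^bsub>B\<^esub> b j \<oplus>\<^bsub>B\<^esub> q i j \<odot>\<^bsub>B\<^esub> (b j \<otimes>\<^bsub>B\<^esub> b i) = \<zero>\<^bsub>B\<^esub>"
      if "i \<in> {1..n}" "j \<in> {1..n}" for i j
      unfolding q[OF that] using b[OF that(1)] b[OF that(2)]
      by (simp add: B.smult_minus_one B.m_comm[of "b j"] B.r_neg)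
    show ?thesis
      by (rule qci_lift[where n = n and q = q and a = a and b = b, OF B(1) b pow rel]) blast+
  qed

  let ?x1 = "\<lambda>i. pure_tensor ?A ?A (?g i) \<one>\<^bsub>?A\<^esub>" and ?x2 = "\<lambda>i. pure_tensor ?A ?A \<one>\<^bsub>?A\<^esub> (?g i)"
  have pure_pow: "pure_tensor ?A ?A x y [^]\<^bsub>?T\<^esub> (m::nat) = pure_tensor ?A ?A (x [^]\<^bsub>?A\<^esub> m) (y [^]\<^bsub>?A\<^esub> m)"
    if "x \<in> carrier ?A" "y \<in> carrier ?A" for x y m
    using that by (induction m) (simp_all add: po pm)
  have pure0: "pure_tensor ?A ?A \<zero>\<^bsub>?A\<^esub> x = \<zero>\<^bsub>?T\<^esub>" "pure_tensor ?A ?A x \<zero>\<^bsub>?A\<^esub> = \<zero>\<^bsub>?T\<^esub>"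
    if "x \<in> carrier ?A" for x
    using that pure_simps(3)[OF A A, of "\<zero>\<^bsub>?A\<^esub>" x 0] pure_simps(4)[OF A A, of x "\<zero>\<^bsub>?A\<^esub>" 0] by simp_all
  have "(?x1 i \<oplus>\<^bsub>?T\<^esub> ?x2 i) [^]\<^bsub>?T\<^esub> a i = \<zero>\<^bsub>?T\<^esub>" if i: "i \<in> {1..n}" for i
  proof -
    obtain e where e: "a i = CHAR('k) ^ e" using a[OF i] by blast
    have "(?x1 i \<oplus>\<^bsub>?T\<^esub> ?x2 i) [^]\<^bsub>?T\<^esub> a i = ?x1 i [^]\<^bsub>?T\<^esub> a i \<oplus>\<^bsub>?T\<^esub> ?x2 i [^]\<^bsub>?T\<^esub> a i"
      unfolding e using i by (intro T.commutative_freshmans_dream[OF p] T.m_comm) simp_all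
    then show ?thesis using i by (simp add: pure_pow qci_gen_pow pure0)
  qed
  then obtain \<Delta> where D: "\<Delta> \<in> alg_hom ?A ?T"
    and Dg: "\<And>i. i \<in> {1..n} \<Longrightarrow> \<Delta> (?g i) = ?x1 i \<oplus>\<^bsub>?T\<^esub> ?x2 i"
    using lift[OF T T.cring_axioms, of "\<lambda>i. ?x1 i \<oplus>\<^bsub>?T\<^esub> ?x2 i"] by auto
  have ground_cring: "cring (ground_alg :: ('k, 'k) module)"
    using k_algebra_ground_alg by (auto simp: k_algebra_def intro!: cring.intro comm_monoid.intro comm_monoid_axioms.intro ring.is_monoid)
  obtain \<epsilon> where E: "\<epsilon> \<in> alg_hom ?A ground_alg" and Eg: "\<And>i. i \<in> {1..n} \<Longrightarrow> \<epsilon> (?g i) = 0"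
  proof -
    have "a i > 0" if "i \<in> {1..n}" for i using a[OF that] p0 by auto
    then show ?thesis
      using lift[OF k_algebra_ground_alg ground_cring, of "\<lambda>i. 0"] that
      by (auto simp: ground_alg_pow zero_power)
  qed
  have "(\<ominus>\<^bsub>?A\<^esub> ?g i) [^]\<^bsub>?A\<^esub> a i = \<zero>\<^bsub>?A\<^esub>" if i: "i \<in> {1..n}" for i
  proof -
    \<comment> \<open>Treating negation as the scalar \<open>-1\<close> avoids distinguishing the
      parity of \<open>a i\<close>.\<close>
    have "(c \<odot>\<^bsub>?A\<^esub> ?g i) [^]\<^bsub>?A\<^esub> m = c ^ m \<odot>\<^bsub>?A\<^esub> (?g i [^]\<^bsub>?A\<^esub> m)" for c and m :: nat
      using i by (induction m) (simp_all add: A.smult_mult_l A.smult_mult_r A.smult_smult)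
    from this[of "-1" "a i"] show ?thesis using i by (simp add: A.smult_minus_one qci_gen_pow)
  qed
  then obtain S where S: "S \<in> alg_hom ?A ?A" and Sg: "\<And>i. i \<in> {1..n} \<Longrightarrow> S (?g i) = \<ominus>\<^bsub>?A\<^esub> ?g i"
    using lift[OF A comm, of "\<lambda>i. \<ominus>\<^bsub>?A\<^esub> ?g i"] by auto
  note hD = alg_homD[OF D] and hE = alg_homD[OF E, simplified] and hS = alg_homD[OF S]
  have id: "(\<lambda>y. y) \<in> alg_hom ?A ?A" by (rule alg_homI) auto

  have coassoc: "tensor_assoc ?A ?A ?A (tensor_map ?T ?A \<Delta> (\<lambda>y. y) (\<Delta> x)) = tensor_map ?A ?T (\<lambda>y. y) \<Delta> (\<Delta> x)"
    if x: "x \<in> carrier ?A" for x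
  proof (rule alg_hom_qci_eqI[OF _ _ _ x])
    note m1 = tensor_map_alg_hom[OF A A T A D id] and m2 = tensor_map_alg_hom[OF A A A T id D]
    note as = tensor_assoc_alg_hom[OF A A A]
    show "(\<lambda>x. tensor_assoc ?A ?A ?A (tensor_map ?T ?A \<Delta> (\<lambda>y. y) (\<Delta> x))) \<in> alg_hom ?A (tensor_alg ?A ?T)"
      by (rule alg_hom_comp[OF alg_hom_comp[OF D m1(1)] as(1)])
    show "(\<lambda>x. tensor_map ?A ?T (\<lambda>y. y) \<Delta> (\<Delta> x)) \<in> alg_hom ?A (tensor_alg ?A ?T)"
      by (rule alg_hom_comp[OF D m2(1)])
    interpret TA: k_algebra "tensor_alg ?T ?A" by (rule k_algebra_tensor_alg[OF T A])
    interpret AT: k_algebra "tensor_alg ?A ?T" by (rule k_algebra_tensor_alg[OF A T])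
    fix i assume i: "i \<in> {1..n}"
    show "tensor_assoc ?A ?A ?A (tensor_map ?T ?A \<Delta> (\<lambda>y. y) (\<Delta> (?g i)))
      = tensor_map ?A ?T (\<lambda>y. y) \<Delta> (\<Delta> (?g i))"
      using i
      by (simp add: Dg alg_homD(1,3)[OF m1(1)] alg_homD(1,3)[OF m2(1)] m1(2) m2(2) hD po
          pure_closed[OF T A] pure_simps[OF T A] pure_closed[OF A T] pure_simps[OF A T]
          alg_homD(1,3)[OF as(1)] as(2) AT.a_assoc)
  qed
  have bl: "bilin ?A ?A ?A (\<lambda>y z. f y \<odot>\<^bsub>?A\<^esub> z)" "bilin ?A ?A ?A (\<lambda>y z. f z \<odot>\<^bsub>?A\<^esub> y)"
    if "f \<in> alg_hom ?A ground_alg" for f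
    using alg_homD[OF that, simplified]
    by (auto intro!: bilinI simp: A.smult_l_distr A.smult_r_distr A.smult_smult mult.commute)
  have bl': "bilin ?A ?A ?A (\<lambda>y z. f y \<otimes>\<^bsub>?A\<^esub> g z)" if "f \<in> alg_hom ?A ?A" "g \<in> alg_hom ?A ?A" for f g
    using alg_homD[OF that(1)] alg_homD[OF that(2)]
    by (auto intro!: bilinI simp: A.l_distr A.r_distr A.smult_mult_l A.smult_mult_r)
  note bE = bl[OF E]
  have hom_E1: "tensor_lift ?A (\<lambda>y z. \<epsilon> y \<odot>\<^bsub>?A\<^esub> z) \<in> alg_hom ?T ?A"
    by (rule tensor_lift_alg_hom[OF A A A bE(1)])
      (simp_all add: hE A.smult_mult_l A.smult_mult_r A.smult_smult mult.commute)
  have hom_E2: "tensor_lift ?A (\<lambda>y z. \<epsilon> z \<odot>\<^bsub>?A\<^esub> y) \<in> alg_hom ?T ?A"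
    by (rule tensor_lift_alg_hom[OF A A A bE(2)])
      (simp_all add: hE A.smult_mult_l A.smult_mult_r A.smult_smult mult.commute)
  have counit1: "tensor_lift ?A (\<lambda>y z. \<epsilon> y \<odot>\<^bsub>?A\<^esub> z) (\<Delta> x) = x" if x: "x \<in> carrier ?A" for x
    by (rule alg_hom_qci_eqI[OF alg_hom_comp[OF D hom_E1] id _ x])
      (simp add: Dg alg_homD(3)[OF hom_E1] tensor_lift_pure[OF A A A bE(1)] hE Eg)
  have counit2: "tensor_lift ?A (\<lambda>y z. \<epsilon> z \<odot>\<^bsub>?A\<^esub> y) (\<Delta> x) = x" if x: "x \<in> carrier ?A" for x
    by (rule alg_hom_qci_eqI[OF alg_hom_comp[OF D hom_E2] id _ x])
      (simp add: Dg alg_homD(3)[OF hom_E2] tensor_lift_pure[OF A A A bE(2)] hE Eg)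
  \<comment> \<open>The right-hand side of both antipode axioms must itself be an algebra
    homomorphism before it can be compared on generators.\<close>
  have unit: "(\<lambda>x. \<epsilon> x \<odot>\<^bsub>?A\<^esub> \<one>\<^bsub>?A\<^esub>) \<in> alg_hom ?A ?A"
    by (rule alg_homI) (simp_all add: hE A.smult_l_distr A.smult_mult_l A.smult_smult)
  note bS = bl'[OF S id] bl'[OF id S]
  have hom_S1: "tensor_lift ?A (\<lambda>y z. S y \<otimes>\<^bsub>?A\<^esub> z) \<in> alg_hom ?T ?A"
    by (rule tensor_lift_alg_hom[OF A A A bS(1)]) (simp_all add: hS A.m_ac)
  have hom_S2: "tensor_lift ?A (\<lambda>y z. y \<otimes>\<^bsub>?A\<^esub> S z) \<in> alg_hom ?T ?A"
    by (rule tensor_lift_alg_hom[OF A A A bS(2)]) (simp_all add: hS A.m_ac)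
  have antipode1: "tensor_lift ?A (\<lambda>y z. S y \<otimes>\<^bsub>?A\<^esub> z) (\<Delta> x) = \<epsilon> x \<odot>\<^bsub>?A\<^esub> \<one>\<^bsub>?A\<^esub>" if x: "x \<in> carrier ?A" for x
    by (rule alg_hom_qci_eqI[OF alg_hom_comp[OF D hom_S1] unit _ x])
      (simp add: Dg alg_homD(3)[OF hom_S1] tensor_lift_pure[OF A A A bS(1)] hS Sg Eg A.l_neg)
  have antipode2: "tensor_lift ?A (\<lambda>y z. y \<otimes>\<^bsub>?A\<^esub> S z) (\<Delta> x) = \<epsilon> x \<odot>\<^bsub>?A\<^esub> \<one>\<^bsub>?A\<^esub>" if x: "x \<in> carrier ?A" for x
    by (rule alg_hom_qci_eqI[OF alg_hom_comp[OF D hom_S2] unit _ x])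
      (simp add: Dg alg_homD(3)[OF hom_S2] tensor_lift_pure[OF A A A bS(2)] hS Sg Eg A.r_neg)
  have "is_bialgebra ?A \<Delta> \<epsilon>"
    unfolding is_bialgebra_def using D E coassoc counit1 counit2 by blast
  moreover have "is_antipode ?A \<Delta> \<epsilon> S"
    unfolding is_antipode_def using alg_hom_lin_map[OF S] antipode1 antipode2 by blast
  ultimately show ?thesis unfolding admits_hopf_algebra_def by blast
qed


theorem theorem4p1:
  fixes n :: nat
    and a :: "nat \<Rightarrow> nat"
    and q :: "nat \<Rightarrow> nat \<Rightarrow> 'k::field"
  assumes "n \<ge> 2"
    and "\<And>i. i \<in> {1..n} \<Longrightarrow> a i \<ge> 2"
    and "\<And>i. i \<in> {1..n} \<Longrightarrow> q i i = -1"
    and "\<And>i j. i \<in> {1..n} \<Longrightarrow> j \<in> {1..n} \<Longrightarrow> q i j * q j i = 1"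
  shows "(admits_hopf_algebra (qci n q a) \<longleftrightarrow> admits_bialgebra (qci n q a)) \<and>
    (admits_bialgebra (qci n q a) \<longleftrightarrow>
       cring (qci n q a) \<and> prime CHAR('k) \<and> (\<forall>i\<in>{1..n}. \<exists>r\<ge>1. a i = CHAR('k) ^ r))"
proof -
  have "admits_bialgebra (qci n q a)" if "admits_hopf_algebra (qci n q a)"
    using that unfolding admits_hopf_algebra_def admits_bialgebra_def by blast
  moreover have "cring (qci n q a) \<and> prime CHAR('k) \<and> (\<forall>i\<in>{1..n}. \<exists>r\<ge>1. a i = CHAR('k) ^ r)"
    if bialg: "admits_bialgebra (qci n q a)"
  proof -
    obtain \<Delta> \<epsilon> where "is_bialgebra (qci n q a) \<Delta> \<epsilon>"
      using bialg unfolding admits_bialgebra_def by blast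
    note bi = assms(2,3) this
    have "cring (qci n q a)" by (rule cring_qci) (rule bialgebra_imp_q[OF bi])
    \<comment> \<open>The index \<open>1\<close> witnesses that there is a generator, as
      \<open>n \<ge> 2\<close>.\<close>
    moreover have "prime CHAR('k)" by (rule bialgebra_imp_prime_power(1)[OF bi, of 1]) (use assms(1) in simp_all)
    moreover have "\<exists>r\<ge>1. a i = CHAR('k) ^ r" if "i \<in> {1..n}" for i
      by (rule bialgebra_imp_prime_power(2)[OF bi that])
    ultimately show ?thesis by simp
  qed
  moreover have "admits_hopf_algebra (qci n q a)"
    if "cring (qci n q a) \<and> prime CHAR('k) \<and> (\<forall>i\<in>{1..n}. \<exists>r\<ge>1. a i = CHAR('k) ^ r)"
  proof (rule qci_primitive_hopf)
    \<comment> \<open>Condition (3) speaks of the algebra only, so the parameters are recovered from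
      its commutativity.\<close>
    show "q i j = -1" if "i \<in> {1..n}" "j \<in> {1..n}" for i j
      using cring_qci_imp_q[where q = q and a = a, OF assms(2,3)] \<open>cring _ \<and> _\<close> that assms(4) by blast
  qed (use that in blast)+
  ultimately show ?thesis by blast
qed

end
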